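(* Let $D$ be a linear differential operator of order $k$, ${\bf z}\in\mathbb{R}^d$, $q>k$, let ${\bf X}=\{{\bf x}_1,\dots,{\bf x}_N\}$ be unisolvent for $\Pi^d_q$, let ${\boldsymbol\theta}=(\theta_1,\dots,\theta_N)$ with $\theta_j\in(0,\infty)$, and let ${\bf w}^{2,{\boldsymbol\theta}}$ be the weight vector of the formula $Df({\bf z})\approx DL^{\boldsymbol\theta}_{{\bf X},q}f({\bf z})=\sum_jw^{2,{\boldsymbol\theta}}_jf({\bf x}_j)$. Let $\Omega$ be a domain containing $S_{{\bf z},{\bf X}}$. Then for all $r\in\{k,\dots,q-1\}$, $\gamma\in(0,1]$ and $f\in C^{r,\gamma}(\Omega)$, $$\Big|Df({\bf z})-\sum_{j=1}^Nw^{2,{\boldsymbol\theta}}_jf({\bf x}_j)\Big|\le\rho_{q,D}({\bf z},{\bf X},\|\cdot\|_{2,{\boldsymbol\theta}^{-1}})\Big(\sum_{j=1}^N\theta_j\|{\bf x}_j-{\bf z}\|_2^{2(r+\gamma)}\Big)^{1/2}|f|_{r,\gamma,\Omega}.$$ If $\Omega$ contains the convex hull of $\{{\bf z},{\bf x}_1,\dots,{\bf x}_N\}$, then for all $f\in W^{r+1}_\infty(\Omega)$, $$\Big|Df({\bf z})-\sum_{j=1}^Nw^{2,{\boldsymbol\theta}}_jf({\bf x}_j)\Big|\le\rho_{q,D}({\bf z},{\bf X},\|\cdot\|_{2,{\boldsymbol\theta}^{-1}})\Big(\sum_{j=1}^N\theta_j\|{\bf x}_j-{\bf z}\|_2^{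2r+2}\Big)^{1/2}|f|_{\infty,r+1,\Omega}.$$
   Context: $\Pi^d_q$: real polynomials in $d$ variables of total degree $<q$. $Df=\sum_{|\alpha|\le k}c_\alpha\partial^\alpha f$, real coefficients, $\sum_{|\alpha|=k}|c_\alpha({\bf z})|\ne0$. ${\bf X}$ consists of distinct points and is unisolvent for $\Pi^d_q$ ($p\in\Pi^d_q$, $p|_{\bf X}=0\Rightarrow p=0$). $L^{\boldsymbol\theta}_{{\bf X},q}f$ is the unique $p\in\Pi^d_q$ minimizing $\sum_j\theta_j(p({\bf x}_j)-f({\bf x}_j))^2$; it depends linearly on $(f({\bf x}_j))_j$, which defines ${\bf w}^{2,{\boldsymbol\theta}}$. ${\bf w}$ is exact of order $q$ if $Dp({\bf z})=\sum_jw_jp({\bf x}_j)$ for all $p\in\Pi^d_q$. $\|{\bf w}\|_{2,{\boldsymbol\theta}^{-1}}:=(\sum_jw_j^2/\theta_j)^{1/2}$ and $\rho_{q,D}({\bf z},{\bf X},\|\cdot\|_{2,{\boldsymbol\theta}^{-1}}):=\inf\{\|{\bf w}\|_{2,{\boldsymbol\theta}^{-1}}:{\bf w}\text{ exact of order }q\}$. $S_{{\bf z},{\bf X}}:=\bigcup_i[{\bf z},{\bf x}_i]$; a domain is an open connected set. $|g|_{\gamma,\Omega}:=\sup_{{\bf x}\ne{\bf y}\in\Omega}|g({\bf x})-g({\bf y})|/\|{\bf x}-{\bf y}\|_2^\gamma$; $C^{r,\gamma}(\Omega)$: $r$ times continuously differentiable $f$ with $|\partial^\alpha f|_{\gamma,\Omega}<\infty$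 for $|\alpha|=r$; $|f|_{r,\gamma,\Omega}:=\frac{1}{(\gamma+1)\cdots(\gamma+r)}\big(\sum_{|\alpha|=r}\frac{r!}{\alpha!}|\partial^\alpha f|_{\gamma,\Omega}^2\big)^{1/2}$. For $f\in W^m_\infty(\Omega)$, $|f|_{\infty,m,\Omega}:=\frac{1}{m!}\big(\sum_{|\alpha|=m}\frac{m!}{\alpha!}\|\partial^\alpha f\|_{L^\infty(\Omega)}^2\big)^{1/2}$. *)

theory Defs
  imports "HOL-Analysis.Analysis"
begin

text \<open>Points of R^d are vectors real^'n (d = CARD('n)); multi-indices are functions 'n => nat.\<close>

definition mabs :: "('n::finite \<Rightarrow> nat) \<Rightarrow> nat" where
  "mabs \<alpha> = (\<Sum>i\<in>UNIV. \<alpha> i)"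

definition mfact :: "('n::finite \<Rightarrow> nat) \<Rightarrow> real" where
  "mfact \<alpha> = (\<Prod>i\<in>UNIV. fact (\<alpha> i))"

definition pdiff :: "'n::finite \<Rightarrow> (real^'n \<Rightarrow> real) \<Rightarrow> real^'n \<Rightarrow> real" where
  "pdiff i g x = deriv (\<lambda>t. g (x + t *\<^sub>R axis i 1)) 0"

definition pdl :: "'n::finite list \<Rightarrow> (real^'n \<Rightarrow> real) \<Rightarrow> real^'n \<Rightarrow> real" where
  "pdl L g = foldr pdiff L g"

text \<open>Partial derivative of multi-index alpha (order of differentiation is
  irrelevant for the C^r functions to which it is applied).\<close>
definition mdiff :: "('n::finite \<Rightarrow> nat) \<Rightarrow> (real^'n \<Rightarrow> real) \<Rightarrow> real^'n \<Rightarrow> real" where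
  "mdiff \<alpha> g = pdl (SOME L. \<forall>i. count_list L i = \<alpha> i) g"

definition Cr :: "nat \<Rightarrow> (real^'n::finite) set \<Rightarrow> (real^'n \<Rightarrow> real) \<Rightarrow> bool" where
  "Cr r \<Omega> f \<longleftrightarrow> (\<forall>L. length L \<le> r \<longrightarrow> continuous_on \<Omega> (pdl L f) \<and>
      (length L < r \<longrightarrow> (\<forall>i. \<forall>x\<in>\<Omega>. (\<lambda>t. pdl L f (x + t *\<^sub>R axis i 1)) differentiable (at 0))))"

definition holder_semi :: "real \<Rightarrow> (real^'n::finite) set \<Rightarrow> (real^'n \<Rightarrow> real) \<Rightarrow> real" where
  "holder_semi \<gamma> \<Omega> g = Sup {\<bar>g x - g y\<bar> / norm (x - y) powr \<gamma> | x y. x \<in> \<Omega> \<and> y \<in> \<Omega> \<and> x \<noteq> y}"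

definition holder_bdd :: "real \<Rightarrow> (real^'n::finite) set \<Rightarrow> (real^'n \<Rightarrow> real) \<Rightarrow> bool" where
  "holder_bdd \<gamma> \<Omega> g \<longleftrightarrow> bdd_above {\<bar>g x - g y\<bar> / norm (x - y) powr \<gamma> | x y. x \<in> \<Omega> \<and> y \<in> \<Omega> \<and> x \<noteq> y}"

definition Crgamma :: "nat \<Rightarrow> real \<Rightarrow> (real^'n::finite) set \<Rightarrow> (real^'n \<Rightarrow> real) \<Rightarrow> bool" where
  "Crgamma r \<gamma> \<Omega> f \<longleftrightarrow> Cr r \<Omega> f \<and> (\<forall>\<alpha>. mabs \<alpha> = r \<longrightarrow> holder_bdd \<gamma> \<Omega> (mdiff \<alpha> f))"

definition Crgamma_semi :: "nat \<Rightarrow> real \<Rightarrow> (real^'n::finite) set \<Rightarrow> (real^'n \<Rightarrow> real) \<Rightarrow> real" where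
  "Crgamma_semi r \<gamma> \<Omega> f = (1 / (\<Prod>i=1..r. (\<gamma> + real i))) *
     sqrt (\<Sum>\<alpha>\<in>{\<alpha>::'n\<Rightarrow>nat. mabs \<alpha> = r}. fact r / mfact \<alpha> * (holder_semi \<gamma> \<Omega> (mdiff \<alpha> f))\<^sup>2)"

definition test_fun :: "(real^'n::finite) set \<Rightarrow> (real^'n \<Rightarrow> real) \<Rightarrow> bool" where
  "test_fun \<Omega> \<phi> \<longleftrightarrow> (\<forall>r. Cr r UNIV \<phi>) \<and> compact (closure {x. \<phi> x \<noteq> 0}) \<and>
      closure {x. \<phi> x \<noteq> 0} \<subseteq> \<Omega>"

definition Linf :: "(real^'n::finite) set \<Rightarrow> (real^'n \<Rightarrow> real) \<Rightarrow> bool" where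
  "Linf \<Omega> g \<longleftrightarrow> set_borel_measurable lborel \<Omega> g \<and> (\<exists>C. AE x in lborel. x \<in> \<Omega> \<longrightarrow> \<bar>g x\<bar> \<le> C)"

definition Linf_norm :: "(real^'n::finite) set \<Rightarrow> (real^'n \<Rightarrow> real) \<Rightarrow> real" where
  "Linf_norm \<Omega> g = Inf {C. 0 \<le> C \<and> (AE x in lborel. x \<in> \<Omega> \<longrightarrow> \<bar>g x\<bar> \<le> C)}"

definition weak_deriv :: "(real^'n::finite) set \<Rightarrow> ('n \<Rightarrow> nat) \<Rightarrow> (real^'n \<Rightarrow> real) \<Rightarrow> (real^'n \<Rightarrow> real) \<Rightarrow> bool" where
  "weak_deriv \<Omega> \<alpha> f g \<longleftrightarrow> (\<forall>\<phi>. test_fun \<Omega> \<phi> \<longrightarrow>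
      set_integrable lborel \<Omega> (\<lambda>x. f x * mdiff \<alpha> \<phi> x) \<and>
      set_integrable lborel \<Omega> (\<lambda>x. g x * \<phi> x) \<and>
      (LINT x:\<Omega>|lborel. f x * mdiff \<alpha> \<phi> x) = (-1) ^ mabs \<alpha> * (LINT x:\<Omega>|lborel. g x * \<phi> x))"

definition Winf :: "nat \<Rightarrow> (real^'n::finite) set \<Rightarrow> (real^'n \<Rightarrow> real) \<Rightarrow> bool" where
  "Winf m \<Omega> f \<longleftrightarrow> Linf \<Omega> f \<and> (\<forall>\<alpha>. mabs \<alpha> \<le> m \<longrightarrow> (\<exists>g. Linf \<Omega> g \<and> weak_deriv \<Omega> \<alpha> f g))"

definition Winf_semi :: "nat \<Rightarrow> (real^'n::finite) set \<Rightarrow> (real^'n \<Rightarrow> real) \<Rightarrow> real" where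
  "Winf_semi m \<Omega> f = (1 / fact m) *
     sqrt (\<Sum>\<alpha>\<in>{\<alpha>::'n\<Rightarrow>nat. mabs \<alpha> = m}. fact m / mfact \<alpha> *
        (Linf_norm \<Omega> (SOME g. Linf \<Omega> g \<and> weak_deriv \<Omega> \<alpha> f g))\<^sup>2)"

definition polys :: "nat \<Rightarrow> (real^'n::finite \<Rightarrow> real) set" where
  "polys q = {p. \<exists>c. p = (\<lambda>y. \<Sum>\<alpha>\<in>{\<alpha>::'n\<Rightarrow>nat. mabs \<alpha> < q}. c \<alpha> * (\<Prod>i\<in>UNIV. (y $ i) ^ \<alpha> i))}"

definition Dop :: "nat \<Rightarrow> (('n::finite \<Rightarrow> nat) \<Rightarrow> real) \<Rightarrow> (real^'n \<Rightarrow> real) \<Rightarrow> real^'n \<Rightarrow> real" where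
  "Dop k c f z = (\<Sum>\<alpha>\<in>{\<alpha>::'n\<Rightarrow>nat. mabs \<alpha> \<le> k}. c \<alpha> * mdiff \<alpha> f z)"

definition unisolvent :: "nat \<Rightarrow> nat \<Rightarrow> (nat \<Rightarrow> real^'n::finite) \<Rightarrow> bool" where
  "unisolvent q N x \<longleftrightarrow> (\<forall>p\<in>polys q. (\<forall>j<N. p (x j) = 0) \<longrightarrow> p = (\<lambda>_. 0))"

definition lsq :: "nat \<Rightarrow> nat \<Rightarrow> (nat \<Rightarrow> real) \<Rightarrow> (nat \<Rightarrow> real^'n::finite) \<Rightarrow> (nat \<Rightarrow> real) \<Rightarrow> (real^'n \<Rightarrow> real)" where
  "lsq q N \<theta> x v = (THE p. p \<in> polys q \<and>
      (\<forall>p'\<in>polys q. (\<Sum>j<N. \<theta> j * (p (x j) - v j)\<^sup>2) \<le> (\<Sum>j<N. \<theta> j * (p' (x j) - v j)\<^sup>2)))"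

definition exact_weights :: "nat \<Rightarrow> nat \<Rightarrow> (('n::finite \<Rightarrow> nat) \<Rightarrow> real) \<Rightarrow> real^'n \<Rightarrow> nat \<Rightarrow> (nat \<Rightarrow> real^'n) \<Rightarrow> (nat \<Rightarrow> real) \<Rightarrow> bool" where
  "exact_weights q k c z N x w \<longleftrightarrow> (\<forall>p\<in>polys q. Dop k c p z = (\<Sum>j<N. w j * p (x j)))"

definition rho :: "nat \<Rightarrow> nat \<Rightarrow> (('n::finite \<Rightarrow> nat) \<Rightarrow> real) \<Rightarrow> real^'n \<Rightarrow> nat \<Rightarrow> (nat \<Rightarrow> real^'n) \<Rightarrow> (nat \<Rightarrow> real) \<Rightarrow> real" where
  "rho q k c z N x \<theta> = Inf {sqrt (\<Sum>j<N. (w j)\<^sup>2 / \<theta> j) | w. exact_weights q k c z N x w}"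

end

theory Submission
  imports Defs "HOL-Combinatorics.Multiset_Permutations"
begin

text \<open>
  The least squares weights reproduce \<open>D\<close> on polynomials, so the error for \<open>f\<close> equals the weighted sum
  of the Taylor remainders \<open>f - T\<close> at the nodes, \<open>T\<close> being the Taylor polynomial of order \<open>r\<close> at \<open>z\<close>.
  Orthogonality of the least squares residual makes these weights minimal among the exact ones for
  the norm dual to \<open>\<theta>\<close>, which gives the factor \<open>\<rho>\<close> after the Cauchy-Schwarz inequality. The remainder
  is estimated along segments: a derivative of order \<open>m\<close> in direction \<open>h\<close> is a sum over words of
  length \<open>m\<close> in the coordinates, a multi-index \<open>\<alpha>\<close> occurring \<open>m! / \<alpha>!\<close> times, so that Cauchy-Schwarz
  over words produces exactly the seminorms of the statement.

  For the Sobolev bound, \<open>f\<close> is mollified. Derivatives of the mollified functions are bounded by the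
  essential bounds of the weak derivatives; since second derivatives bound the defect of difference
  quotients, uniform convergence propagates to all derivatives up to order \<open>r\<close> near \<open>z\<close>, and the
  estimate passes to the limit.
\<close>

subsection \<open>Partial derivatives\<close>

text \<open>The theorem speaks of classical derivatives of \<open>f\<close> at \<open>z\<close>,
  whereas a Sobolev function comes only with weak ones; continuity fixes the representative, so that
  point values make sense. A nonnegative kernel of mass one preserves essential bounds without any
  extra factor, so the mollified functions satisfy the Taylor estimate with the seminorm of
  \<open>f\<close> itself. What remains is convergence at the nodes and of the derivatives of order
  at most \<open>k\<close> at \<open>z\<close>. Since the union of the segments is compact, it keeps
  a positive distance from the complement of \<Omega>, and small mollification radii never leave
  \<Omega>.

  Words replace multi-indices because the chain rule along a line merely prepends a letter. Symmetry
  of mixed partials enters in one place: to pass from an arbitrary word to \<open>mdiff\<close>,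
  which picks its word by \<open>SOME\<close>.

  The constant 1/((\<gamma>+1)...(\<gamma>+r)) arises from integrating t^\<gamma> exactly r times.
  For \<gamma> = 1 it equals 1/(r+1)!, the factor of the Sobolev seminorm, so both bounds rest on a
  single Taylor estimate.\<close>

definition has_partial :: "(real^'n::finite \<Rightarrow> real) \<Rightarrow> 'n \<Rightarrow> real \<Rightarrow> real^'n \<Rightarrow> bool" where
  "has_partial g i D x \<longleftrightarrow> ((\<lambda>t. g (x + t *\<^sub>R axis i 1)) has_real_derivative D) (at 0)"

lemma has_partial_pdiff: "has_partial g i D x \<Longrightarrow> pdiff i g x = D"
  by (simp add: has_partial_def pdiff_def DERIV_imp_deriv)

lemma has_partial_shift:
  assumes "has_partial g i D (x + s *\<^sub>R axis i 1)"
  shows "((\<lambda>t. g (x + t *\<^sub>R axis i 1)) has_real_derivative D) (at s)"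
proof -
  have "((\<lambda>t. g (x + s *\<^sub>R axis i 1 + t *\<^sub>R axis i 1)) has_real_derivative D) (at 0)"
    using assms by (simp add: has_partial_def)
  then have "((\<lambda>t. g (x + (t + s) *\<^sub>R axis i 1)) has_real_derivative D) (at 0)"
    by (simp add: algebra_simps)
  then show ?thesis
    using DERIV_shift[of "\<lambda>t. g (x + t *\<^sub>R axis i 1)" D 0 s] by simp
qed

lemma pdl_Nil [simp]: "pdl [] g = g"
  and pdl_Cons [simp]: "pdl (i # L) g = pdiff i (pdl L g)"
  by (simp_all add: pdl_def)

text \<open>\<open>deriv\<close> is total and by itself says nothing about existence. Presenting all
  derivatives at once, as a family indexed by words and certified letter by letter, settles
  existence and value together. Polynomials, kernels and convolutions are all differentiated this
  way.\<close>

lemma pdl_eq_family: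
  assumes "P [] = g" "\<And>L i x. has_partial (P L) i (P (i # L) x) x"
  shows "pdl L g = P L"
proof (induction L)
  case (Cons i L)
  then show ?case using has_partial_pdiff[OF assms(2)] by auto
qed (simp add: assms)

lemma Cr_family:
  assumes "P [] = g" "\<And>L i x. has_partial (P L) i (P (i # L) x) x" "\<And>L. continuous_on UNIV (P L)"
  shows "Cr r UNIV g"
proof -
  have "pdl L g = P L" for L
    using assms(1,2) by (rule pdl_eq_family)
  then show ?thesis
    using assms(2,3) unfolding Cr_def has_partial_def real_differentiable_def by metis
qed

text \<open>\<open>F a i m\<close> stands for the m-th derivative of the i-th factor of the a-th
  product, so differentiation only raises counters. The form covers Taylor polynomials, where
  \<open>a\<close> runs over multi-indices, and the mollifier, which is a single product.\<close>

definition sum_prod :: "'a set \<Rightarrow> ('a \<Rightarrow> real) \<Rightarrow> ('a \<Rightarrow> 'n::finite \<Rightarrow> nat \<Rightarrow> real \<Rightarrow> real)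
    \<Rightarrow> 'n list \<Rightarrow> real^'n \<Rightarrow> real" where
  "sum_prod A b F L x = (\<Sum>a\<in>A. b a * (\<Prod>i\<in>UNIV. F a i (count_list L i) (x $ i)))"

lemma sum_prod_partial:
  assumes "\<And>a i m t. (F a i m has_real_derivative F a i (Suc m) t) (at t)"
  shows "has_partial (sum_prod A b F L) j (sum_prod A b F (j # L) x) x"
proof -
  have "((\<lambda>t. \<Prod>i\<in>UNIV. F a i (count_list L i) ((x + t *\<^sub>R axis j 1) $ i)) has_real_derivative
      (\<Prod>i\<in>UNIV. F a i (count_list (j # L) i) (x $ i))) (at 0)" for a
  proof -
    let ?m = "\<lambda>i. count_list L i"
    have eq: "(\<lambda>t. \<Prod>i\<in>UNIV. F a i (?m i) ((x + t *\<^sub>R axis j 1) $ i))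
      = (\<lambda>t. F a j (?m j) (x $ j + t) * (\<Prod>i\<in>UNIV - {j}. F a i (?m i) (x $ i)))"
      by (subst prod.remove[of _ j]) (auto simp: axis_def intro!: ext arg_cong2[of _ _ _ _ "(*)"] prod.cong)
    have eq2: "(\<Prod>i\<in>UNIV. F a i (count_list (j # L) i) (x $ i))
      = F a j (Suc (?m j)) (x $ j) * (\<Prod>i\<in>UNIV - {j}. F a i (?m i) (x $ i))"
      by (subst prod.remove[of _ j]) (auto intro!: arg_cong2[of _ _ _ _ "(*)"] prod.cong)
    have "((\<lambda>t. F a j (?m j) (t + x $ j)) has_real_derivative F a j (Suc (?m j)) (x $ j)) (at 0)"
      using DERIV_shift[of "F a j (?m j)" "F a j (Suc (?m j)) (x $ j)" 0 "x $ j"] assms by simp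
    then show ?thesis
      unfolding eq eq2 by (intro DERIV_cmult_right) (simp add: add.commute)
  qed
  then show ?thesis
    unfolding has_partial_def sum_prod_def by (intro DERIV_sum DERIV_cmult)
qed

lemma sum_prod_continuous:
  fixes F :: "'a \<Rightarrow> 'n::finite \<Rightarrow> nat \<Rightarrow> real \<Rightarrow> real"
  assumes "\<And>a i m t. (F a i m has_real_derivative F a i (Suc m) t) (at t)"
  shows "continuous_on UNIV (sum_prod A b F L)"
proof -
  have "continuous_on UNIV (\<lambda>x::real^'n. F a i m (x $ i))" for a i m
  proof (rule continuous_on_compose2[of UNIV "F a i m"])
    show "continuous_on UNIV (F a i m)"
      using DERIV_isCont[OF assms] by (intro continuous_at_imp_continuous_on) blast
  qed (auto intro!: continuous_intros)
  then show ?thesis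
    unfolding sum_prod_def by (intro continuous_intros) auto
qed

lemma sum_prod_pdl:
  assumes "\<And>a i m t. (F a i m has_real_derivative F a i (Suc m) t) (at t)"
  shows "pdl L (sum_prod A b F []) = sum_prod A b F L"
  by (rule pdl_eq_family[of "sum_prod A b F"]) (auto intro: sum_prod_partial assms)

subsection \<open>Multi-indices and lists\<close>

definition mlist :: "('n::finite \<Rightarrow> nat) \<Rightarrow> 'n list" where
  "mlist \<alpha> = (SOME L. \<forall>i. count_list L i = \<alpha> i)"

lemma mdiff_mlist: "mdiff \<alpha> g = pdl (mlist \<alpha>) g"
  by (simp add: mdiff_def mlist_def)

lemma count_mlist [simp]: "count_list (mlist \<alpha>) = \<alpha>"
proof -
  obtain L where L: "mset L = Abs_multiset \<alpha>" using ex_mset by blast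
  have "count_list L i = \<alpha> i" for i
    using L by (simp flip: count_mset add: count_Abs_multiset)
  then have "\<forall>i. count_list (mlist \<alpha>) i = \<alpha> i"
    unfolding mlist_def by (intro someI[of "\<lambda>L. \<forall>i. count_list L i = \<alpha> i" L]) simp
  then show ?thesis by auto
qed

lemma mabs_count_list [simp]: "mabs (count_list L) = length L"
  by (simp add: mabs_def sum_count_set)

lemma length_mlist [simp]: "length (mlist \<alpha>) = mabs \<alpha>"
  by (metis count_mlist mabs_count_list)

lemma finite_lists_of_length: "finite {L :: 'n::finite list. length L = m}"
  using finite_lists_length_eq[of "UNIV :: 'n set" m] by simp

lemma multi_indices_eq_image: "{\<alpha> :: 'n::finite \<Rightarrow> nat. mabs \<alpha> = m} = count_list ` {L. length L = m}"
proof -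
  have "\<alpha> \<in> count_list ` {L. length L = mabs \<alpha>}" for \<alpha> :: "'n \<Rightarrow> nat"
    by (rule image_eqI[of _ _ "mlist \<alpha>"]) simp_all
  then show ?thesis by auto
qed

lemma finite_multi_indices [simp]:
  "finite {\<alpha> :: 'n::finite \<Rightarrow> nat. mabs \<alpha> = m}"
  "finite {\<alpha> :: 'n::finite \<Rightarrow> nat. mabs \<alpha> < m}"
  "finite {\<alpha> :: 'n::finite \<Rightarrow> nat. mabs \<alpha> \<le> m}"
proof -
  show fin: "finite {\<alpha> :: 'n::finite \<Rightarrow> nat. mabs \<alpha> = m}" for m
    unfolding multi_indices_eq_image using finite_lists_of_length by blast
  have "{\<alpha> :: 'n::finite \<Rightarrow> nat. mabs \<alpha> \<le> m} = (\<Union>j\<le>m. {\<alpha>. mabs \<alpha> = j})" by auto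
  then show "finite {\<alpha> :: 'n::finite \<Rightarrow> nat. mabs \<alpha> \<le> m}" using fin by simp
  then show "finite {\<alpha> :: 'n::finite \<Rightarrow> nat. mabs \<alpha> < m}"
    by (rule rev_finite_subset) auto
qed

text \<open>The words with letter counts \<alpha> are the permutations of the multiset with
  multiplicities \<alpha>, and these are counted by the multinomial coefficient.\<close>

lemma card_lists_count:
  fixes \<alpha> :: "'n::finite \<Rightarrow> nat"
  shows "real (card {L. count_list L = \<alpha>}) = fact (mabs \<alpha>) / mfact \<alpha>"
proof -
  define A where "A = Abs_multiset \<alpha>"
  have c: "count A = \<alpha>" unfolding A_def by (rule count_Abs_multiset) simp
  have eq: "{L. count_list L = \<alpha>} = permutations_of_multiset A"
    unfolding permutations_of_multiset_def
    by (auto simp: multiset_eq_iff c fun_eq_iff count_mset)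
  have "size A = mabs \<alpha>"
    unfolding size_multiset_overloaded_eq mabs_def c
    by (rule sum.mono_neutral_left) (auto simp: count_eq_zero_iff simp flip: c)
  moreover have "(\<Prod>x\<in>set_mset A. fact (count A x)) = (\<Prod>i\<in>UNIV. fact (\<alpha> i) :: nat)"
    unfolding c by (rule prod.mono_neutral_left) (auto simp: not_in_iff c)
  ultimately have "card {L. count_list L = \<alpha>} * (\<Prod>i\<in>UNIV. fact (\<alpha> i)) = (fact (mabs \<alpha>) :: nat)"
    using card_permutations_of_multiset_aux[of A] unfolding eq by simp
  then have "real (card {L. count_list L = \<alpha>}) * mfact \<alpha> = fact (mabs \<alpha>)"
    by (auto dest: arg_cong[of _ _ real] simp: mfact_def)
  moreover have "mfact \<alpha> \<noteq> 0" by (simp add: mfact_def)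
  ultimately show ?thesis by (metis nonzero_mult_div_cancel_right)
qed

lemma sum_lists_multinomial:
  fixes H :: "('n::finite \<Rightarrow> nat) \<Rightarrow> real"
  shows "(\<Sum>L | length L = m. H (count_list L)) = (\<Sum>\<alpha> | mabs \<alpha> = m. fact m / mfact \<alpha> * H \<alpha>)"
proof -
  have "(\<Sum>L | length L = m. H (count_list L)) =
      (\<Sum>\<alpha> | mabs \<alpha> = m. \<Sum>L\<in>{L\<in>{L. length L = m}. count_list L = \<alpha>}. H (count_list L))"
    by (rule sum.group[symmetric]) (auto simp: finite_lists_of_length)
  also have "\<dots> = (\<Sum>\<alpha> | mabs \<alpha> = m. fact m / mfact \<alpha> * H \<alpha>)"
  proof (rule sum.cong)
    fix \<alpha> :: "'n \<Rightarrow> nat" assume "\<alpha> \<in> {\<alpha>. mabs \<alpha> = m}"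
    then have "{L\<in>{L. length L = m}. count_list L = \<alpha>} = {L. count_list L = \<alpha>}" by auto
    then show "(\<Sum>L\<in>{L\<in>{L. length L = m}. count_list L = \<alpha>}. H (count_list L)) = fact m / mfact \<alpha> * H \<alpha>"
      using \<open>\<alpha> \<in> _\<close> card_lists_count[of \<alpha>] by simp
  qed simp
  finally show ?thesis .
qed

lemma sum_lists_Suc:
  fixes H :: "'n::finite list \<Rightarrow> 'b::comm_monoid_add"
  shows "(\<Sum>L | length L = Suc m. H L) = (\<Sum>L | length L = m. \<Sum>i\<in>UNIV. H (i # L))"
proof -
  have "(\<Sum>L | length L = m. \<Sum>i\<in>UNIV. H (i # L)) = (\<Sum>(L, i) \<in> {L. length L = m} \<times> UNIV. H (i # L))"
    by (rule sum.cartesian_product)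
  also have "\<dots> = (\<Sum>L | length L = Suc m. H L)"
    by (rule sum.reindex_bij_witness[of _ "\<lambda>L. (tl L, hd L)" "\<lambda>(L, i). i # L"])
      (auto simp: length_Suc_conv)
  finally show ?thesis by simp
qed

section \<open>Monomials as products over words\<close>

definition lpow :: "real^'n::finite \<Rightarrow> 'n list \<Rightarrow> real" where
  "lpow h L = (\<Prod>i\<leftarrow>L. h $ i)"

lemma lpow_Nil [simp]: "lpow h [] = 1" and lpow_Cons [simp]: "lpow h (i # L) = h $ i * lpow h L"
  by (simp_all add: lpow_def)

lemma lpow_prod: "lpow h L = (\<Prod>i\<in>UNIV. (h $ i) ^ count_list L i)"
proof (induction L)
  case (Cons j L)
  have "(\<Prod>i\<in>UNIV. (h $ i) ^ count_list (j # L) i)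
      = (\<Prod>i\<in>UNIV. (if i = j then h $ i else 1) * (h $ i) ^ count_list L i)"
    by (rule prod.cong) auto
  also have "\<dots> = h $ j * (\<Prod>i\<in>UNIV. (h $ i) ^ count_list L i)"
    by (simp add: prod.distrib prod.delta)
  finally show ?case using Cons by simp
qed simp

text \<open>This is the m-th power of the sum of the squared coordinates, multiplied out word by
  word. It is the reason why the Euclidean norm appears with constant one.\<close>

lemma sum_lpow_squared: "(\<Sum>L | length L = m. (lpow h L)\<^sup>2) = norm h ^ (2 * m)"
proof (induction m)
  case (Suc m)
  have "(\<Sum>L | length L = Suc m. (lpow h L)\<^sup>2) = (\<Sum>L | length L = m. \<Sum>i\<in>UNIV. (h $ i)\<^sup>2 * (lpow h L)\<^sup>2)"
    by (simp add: sum_lists_Suc power_mult_distrib)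
  also have "\<dots> = (\<Sum>i\<in>UNIV. (h $ i)\<^sup>2) * (\<Sum>L | length L = m. (lpow h L)\<^sup>2)"
    by (simp add: sum_distrib_left sum_distrib_right)
  also have "(\<Sum>i\<in>UNIV. (h $ i)\<^sup>2) = (norm h)\<^sup>2"
    by (simp add: norm_vec_def L2_set_def sum_nonneg)
  finally show ?case using Suc by (simp add: power_add[symmetric])
qed simp

lemma sum_lpow_le:
  fixes B :: "('n::finite \<Rightarrow> nat) \<Rightarrow> real"
  assumes "\<And>L. length L = m \<Longrightarrow> \<bar>a L\<bar> \<le> B (count_list L)"
  shows "\<bar>\<Sum>L | length L = m. lpow h L * a L\<bar>
    \<le> norm h ^ m * sqrt (\<Sum>\<alpha> | mabs \<alpha> = m. fact m / mfact \<alpha> * (B \<alpha>)\<^sup>2)"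
proof -
  have "\<bar>\<Sum>L | length L = m. lpow h L * a L\<bar> \<le> (\<Sum>L | length L = m. \<bar>lpow h L\<bar> * \<bar>B (count_list L)\<bar>)"
    by (rule sum_abs[THEN order_trans], rule sum_mono)
      (use assms in \<open>fastforce simp: abs_mult intro!: mult_left_mono\<close>)
  also have "\<dots> \<le> sqrt (\<Sum>L | length L = m. (lpow h L)\<^sup>2) * sqrt (\<Sum>L | length L = m. (B (count_list L))\<^sup>2)"
    using L2_set_mult_ineq by (auto simp: L2_set_def)
  also have "\<dots> = norm h ^ m * sqrt (\<Sum>\<alpha> | mabs \<alpha> = m. fact m / mfact \<alpha> * (B \<alpha>)\<^sup>2)"
    using sum_lists_multinomial[of "\<lambda>\<alpha>. (B \<alpha>)\<^sup>2" m]
    by (simp add: sum_lpow_squared power_even_eq)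
  finally show ?thesis .
qed

subsection \<open>Mean values and differentiability\<close>

lemma signed_mvt:
  fixes g :: "real \<Rightarrow> real"
  assumes "\<And>s. \<bar>s\<bar> \<le> \<bar>t\<bar> \<Longrightarrow> (g has_real_derivative g' s) (at s)"
  obtains \<xi> where "\<bar>\<xi>\<bar> \<le> \<bar>t\<bar>" "g t - g 0 = t * g' \<xi>"
proof -
  consider "t = 0" | "t > 0" | "t < 0" by linarith
  then show ?thesis
  proof cases
    case 1 then show ?thesis using that[of 0] by simp
  next
    case 2
    then obtain \<xi> where "0 < \<xi>" "\<xi> < t" "g t - g 0 = (t - 0) * g' \<xi>"
      using MVT2[of 0 t g g'] assms by auto
    then show ?thesis using that[of \<xi>] by auto
  next
    case 3
    then obtain \<xi> where "t < \<xi>" "\<xi> < 0" "g 0 - g t = (0 - t) * g' \<xi>"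
      using MVT2[of t 0 g g'] assms by auto
    then show ?thesis using that[of \<xi>] by auto
  qed
qed

text \<open>Two mean value steps lose a factor 2 against Taylor's constant \<open>M / 2\<close>;
  later uses only need the order \<open>t\<^sup>2\<close> and uniformity in the base point.\<close>

lemma second_order_bound:
  fixes g :: "real \<Rightarrow> real"
  assumes "\<And>s. \<bar>s\<bar> \<le> \<bar>t\<bar> \<Longrightarrow> (g has_real_derivative g1 s) (at s)"
    and "\<And>s. \<bar>s\<bar> \<le> \<bar>t\<bar> \<Longrightarrow> (g1 has_real_derivative g2 s) (at s)"
    and "\<And>s. \<bar>s\<bar> \<le> \<bar>t\<bar> \<Longrightarrow> \<bar>g2 s\<bar> \<le> M"
  shows "\<bar>g t - g 0 - t * g1 0\<bar> \<le> M * t\<^sup>2"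
proof -
  obtain \<xi> where \<xi>: "\<bar>\<xi>\<bar> \<le> \<bar>t\<bar>" "g t - g 0 = t * g1 \<xi>"
    using signed_mvt[of t g g1] assms(1) by blast
  have "(g1 has_real_derivative g2 s) (at s)" if "\<bar>s\<bar> \<le> \<bar>\<xi>\<bar>" for s
    using assms(2) that \<xi>(1) by simp
  then obtain \<eta> where \<eta>: "\<bar>\<eta>\<bar> \<le> \<bar>\<xi>\<bar>" "g1 \<xi> - g1 0 = \<xi> * g2 \<eta>"
    using signed_mvt[of \<xi> g1 g2] by blast
  have "g t - g 0 - t * g1 0 = t * (\<xi> * g2 \<eta>)"
    unfolding \<xi>(2) \<eta>(2)[symmetric] by (simp add: algebra_simps)
  then have "\<bar>g t - g 0 - t * g1 0\<bar> = \<bar>t\<bar> * (\<bar>\<xi>\<bar> * \<bar>g2 \<eta>\<bar>)"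
    by (simp add: abs_mult)
  also have "\<dots> \<le> \<bar>t\<bar> * (\<bar>t\<bar> * M)"
    using \<xi>(1) \<eta>(1) assms(3)[of \<eta>] by (intro mult_left_mono mult_mono) auto
  also have "\<dots> = M * t\<^sup>2"
    by (simp add: power2_eq_square mult.assoc[symmetric])
  finally show ?thesis .
qed

lemma partial_mvt:
  assumes "\<And>s. \<bar>s\<bar> \<le> \<bar>t\<bar> \<Longrightarrow> has_partial g i (D (x + s *\<^sub>R axis i 1)) (x + s *\<^sub>R axis i 1)"
  obtains \<xi> where "\<bar>\<xi>\<bar> \<le> \<bar>t\<bar>" "g (x + t *\<^sub>R axis i 1) - g x = t * D (x + \<xi> *\<^sub>R axis i 1)"
  using signed_mvt[of t "\<lambda>t. g (x + t *\<^sub>R axis i 1)" "\<lambda>s. D (x + s *\<^sub>R axis i 1)"]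
    has_partial_shift[OF assms] by auto

lemma partial_second_order_bound:
  assumes "\<And>s. \<bar>s\<bar> \<le> \<bar>t\<bar> \<Longrightarrow> has_partial g i (D (x + s *\<^sub>R axis i 1)) (x + s *\<^sub>R axis i 1)"
    and "\<And>s. \<bar>s\<bar> \<le> \<bar>t\<bar> \<Longrightarrow> has_partial D i (E (x + s *\<^sub>R axis i 1)) (x + s *\<^sub>R axis i 1)"
    and "\<And>s. \<bar>s\<bar> \<le> \<bar>t\<bar> \<Longrightarrow> \<bar>E (x + s *\<^sub>R axis i 1)\<bar> \<le> M"
  shows "\<bar>g (x + t *\<^sub>R axis i 1) - g x - t * D x\<bar> \<le> M * t\<^sup>2"
  using second_order_bound[of t "\<lambda>t. g (x + t *\<^sub>R axis i 1)" "\<lambda>s. D (x + s *\<^sub>R axis i 1)"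
      "\<lambda>s. E (x + s *\<^sub>R axis i 1)" M] has_partial_shift[OF assms(1)] has_partial_shift[OF assms(2)] assms(3)
  by simp

lemma has_partial_translate: "has_partial g i D (x + v) \<Longrightarrow> has_partial (\<lambda>y. g (y + v)) i D x"
  unfolding has_partial_def by (simp add: ac_simps)

lemma has_partial_diff: "has_partial f i D x \<Longrightarrow> has_partial g i E x \<Longrightarrow> has_partial (\<lambda>y. f y - g y) i (D - E) x"
  unfolding has_partial_def by (rule DERIV_diff)

text \<open>The mean value theorem is applied in direction \<open>i\<close> to the increment of
  \<open>f\<close> in direction \<open>j\<close>, and then in direction \<open>j\<close> to
  \<open>fi\<close>.\<close>

lemma second_difference:
  assumes sub: "ball x \<delta> \<subseteq> \<Omega>" and s: "0 < s" "3 * s \<le> \<delta>"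
    and fi: "\<And>y. y \<in> \<Omega> \<Longrightarrow> has_partial f i (fi y) y"
    and fij: "\<And>y. y \<in> \<Omega> \<Longrightarrow> has_partial fi j (fij y) y"
  obtains y where "y \<in> ball x \<delta>"
    "f (x + s *\<^sub>R axis i 1 + s *\<^sub>R axis j 1) - f (x + s *\<^sub>R axis i 1) - f (x + s *\<^sub>R axis j 1) + f x = s\<^sup>2 * fij y"
proof -
  \<comment> \<open>The points used lie within \<open>2 * s\<close> of \<open>x\<close>; the
    assumption \<open>3 * s \<le> \<delta>\<close> keeps them strictly inside the ball.\<close>
  have inb: "x + a *\<^sub>R axis i 1 + b *\<^sub>R axis j 1 \<in> ball x \<delta>" if "\<bar>a\<bar> \<le> s" "\<bar>b\<bar> \<le> s" for a b
  proof -
    have "norm (a *\<^sub>R axis i 1 + b *\<^sub>R axis j (1::real)) \<le> \<bar>a\<bar> + \<bar>b\<bar>"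
      using norm_triangle_ineq[of "a *\<^sub>R axis i (1::real)" "b *\<^sub>R axis j 1"] by (simp add: norm_axis_1)
    also have "\<dots> < \<delta>" using that s by linarith
    finally have "norm (- (a *\<^sub>R axis i 1 + b *\<^sub>R axis j (1::real))) < \<delta>" by (simp only: norm_minus_cancel)
    then show ?thesis by (simp add: dist_norm algebra_simps)
  qed
  define g where "g y = f (y + s *\<^sub>R axis j 1) - f y" for y
  have "has_partial g i (fi (x + a *\<^sub>R axis i 1 + s *\<^sub>R axis j 1) - fi (x + a *\<^sub>R axis i 1)) (x + a *\<^sub>R axis i 1)"
    if "\<bar>a\<bar> \<le> \<bar>s\<bar>" for a
    unfolding g_def using inb[of a s] inb[of a 0] that s sub
    by (intro has_partial_diff has_partial_translate fi) auto
  then obtain \<xi> where \<xi>: "\<bar>\<xi>\<bar> \<le> \<bar>s\<bar>"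
    "g (x + s *\<^sub>R axis i 1) - g x = s * (fi (x + \<xi> *\<^sub>R axis i 1 + s *\<^sub>R axis j 1) - fi (x + \<xi> *\<^sub>R axis i 1))"
    using partial_mvt[of s g i "\<lambda>y. fi (y + s *\<^sub>R axis j 1) - fi y" x] by blast
  have "has_partial fi j (fij (x + \<xi> *\<^sub>R axis i 1 + b *\<^sub>R axis j 1)) (x + \<xi> *\<^sub>R axis i 1 + b *\<^sub>R axis j 1)"
    if "\<bar>b\<bar> \<le> \<bar>s\<bar>" for b
    using inb[of \<xi> b] \<xi>(1) that s sub by (intro fij) auto
  then obtain \<eta> where \<eta>: "\<bar>\<eta>\<bar> \<le> \<bar>s\<bar>"
    "fi (x + \<xi> *\<^sub>R axis i 1 + s *\<^sub>R axis j 1) - fi (x + \<xi> *\<^sub>R axis i 1) = s * fij (x + \<xi> *\<^sub>R axis i 1 + \<eta> *\<^sub>R axis j 1)"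
    using partial_mvt[of s fi j fij "x + \<xi> *\<^sub>R axis i 1"] by blast
  show ?thesis
  proof
    show "x + \<xi> *\<^sub>R axis i 1 + \<eta> *\<^sub>R axis j 1 \<in> ball x \<delta>" using inb \<xi>(1) \<eta>(1) s by auto
    show "f (x + s *\<^sub>R axis i 1 + s *\<^sub>R axis j 1) - f (x + s *\<^sub>R axis i 1) - f (x + s *\<^sub>R axis j 1) + f x
        = s\<^sup>2 * fij (x + \<xi> *\<^sub>R axis i 1 + \<eta> *\<^sub>R axis j 1)"
      using \<xi>(2) \<eta>(2) by (simp add: g_def power2_eq_square)
  qed
qed

text \<open>The second difference is symmetric in \<open>i\<close> and \<open>j\<close>, so it
  produces equal values of \<open>fij\<close> and \<open>fji\<close> at two points close to
  \<open>x\<close>. With \<open>e\<close> half the supposed gap at \<open>x\<close>, continuity of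
  both functions is violated.\<close>

lemma mixed_partials_commute:
  assumes op: "open \<Omega>" "x \<in> \<Omega>"
    and fi: "\<And>y. y \<in> \<Omega> \<Longrightarrow> has_partial f i (fi y) y"
    and fj: "\<And>y. y \<in> \<Omega> \<Longrightarrow> has_partial f j (fj y) y"
    and fij: "\<And>y. y \<in> \<Omega> \<Longrightarrow> has_partial fi j (fij y) y"
    and fji: "\<And>y. y \<in> \<Omega> \<Longrightarrow> has_partial fj i (fji y) y"
    and cont: "continuous_on \<Omega> fij" "continuous_on \<Omega> fji"
  shows "fij x = fji x"
proof (rule ccontr)
  assume "fij x \<noteq> fji x"
  define e where "e = \<bar>fij x - fji x\<bar> / 2"
  have e: "e > 0" using \<open>fij x \<noteq> fji x\<close> by (simp add: e_def)
  obtain d0 where d0: "d0 > 0" "ball x d0 \<subseteq> \<Omega>" using op open_contains_ball by blast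
  obtain d1 where d1: "d1 > 0" "\<And>y. y \<in> \<Omega> \<Longrightarrow> dist y x < d1 \<Longrightarrow> dist (fij y) (fij x) < e"
    using cont(1) op(2) e unfolding continuous_on_iff by metis
  obtain d2 where d2: "d2 > 0" "\<And>y. y \<in> \<Omega> \<Longrightarrow> dist y x < d2 \<Longrightarrow> dist (fji y) (fji x) < e"
    using cont(2) op(2) e unfolding continuous_on_iff by metis
  define \<delta> where "\<delta> = min d0 (min d1 d2)"
  define s where "s = \<delta> / 3"
  have s: "0 < s" "3 * s \<le> \<delta>" and sub: "ball x \<delta> \<subseteq> \<Omega>"
    using d0 d1 d2 by (auto simp: s_def \<delta>_def)
  obtain y where y: "y \<in> ball x \<delta>"
    "f (x + s *\<^sub>R axis i 1 + s *\<^sub>R axis j 1) - f (x + s *\<^sub>R axis i 1) - f (x + s *\<^sub>R axis j 1) + f x = s\<^sup>2 * fij y"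
    using second_difference[OF sub s fi fij] by blast
  obtain y' where y': "y' \<in> ball x \<delta>"
    "f (x + s *\<^sub>R axis j 1 + s *\<^sub>R axis i 1) - f (x + s *\<^sub>R axis j 1) - f (x + s *\<^sub>R axis i 1) + f x = s\<^sup>2 * fji y'"
    using second_difference[OF sub s fj fji] by blast
  have "s\<^sup>2 * fij y = s\<^sup>2 * fji y'" using y(2) y'(2) by (simp add: algebra_simps)
  then have "fij y = fji y'" using s by simp
  moreover have "\<bar>fij y - fij x\<bar> < e"
    using d1(2)[of y] y(1) sub by (auto simp: \<delta>_def dist_norm norm_minus_commute)
  moreover have "\<bar>fji y' - fji x\<bar> < e"
    using d2(2)[of y'] y'(1) sub by (auto simp: \<delta>_def dist_norm norm_minus_commute)
  ultimately show False unfolding e_def by (auto simp: abs_if split: if_splits)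
qed

text \<open>The coordinates of \<open>h\<close> are switched on one at a time, by induction on the
  set \<open>I\<close> of those already moved. Half of \<open>e\<close> goes to the induction
  hypothesis, the other half to the new coordinate, where the mean value theorem and continuity of
  \<open>D j\<close> apply.\<close>

lemma has_derivative_of_continuous_partials:
  fixes f :: "real^'n::finite \<Rightarrow> real"
  assumes op: "open \<Omega>" "x \<in> \<Omega>"
    and D: "\<And>i y. y \<in> \<Omega> \<Longrightarrow> has_partial f i (D i y) y"
    and cont: "\<And>i. continuous_on \<Omega> (D i)"
  shows "(f has_derivative (\<lambda>h. \<Sum>i\<in>UNIV. h $ i * D i x)) (at x)"
proof -
  have norm_part: "norm (\<Sum>i\<in>I. h $ i *\<^sub>R axis i (1::real)) \<le> real CARD('n) * norm h"
    for I and h :: "real^'n"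
  proof -
    have "norm (\<Sum>i\<in>I. h $ i *\<^sub>R axis i (1::real)) \<le> (\<Sum>i\<in>I. norm h)"
      by (rule sum_norm_le) (simp add: norm_axis_1 component_le_norm_cart)
    also have "\<dots> \<le> real CARD('n) * norm h"
      by (simp add: card_mono mult_right_mono)
    finally show ?thesis .
  qed
  have part: "\<exists>d>0. \<forall>h. norm h < d \<longrightarrow>
      \<bar>f (x + (\<Sum>i\<in>I. h $ i *\<^sub>R axis i 1)) - f x - (\<Sum>i\<in>I. h $ i * D i x)\<bar> \<le> e * norm h" if "e > 0" for I e
    using finite[of I] that
  proof (induction I arbitrary: e rule: finite_induct)
    case empty
    then show ?case by (auto intro: exI[of _ 1])
  next
    case (insert j I)
    obtain d1 where d1: "d1 > 0" "\<And>h. norm h < d1 \<Longrightarrow>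
      \<bar>f (x + (\<Sum>i\<in>I. h $ i *\<^sub>R axis i 1)) - f x - (\<Sum>i\<in>I. h $ i * D i x)\<bar> \<le> e / 2 * norm h"
      using insert.IH[of "e / 2"] insert.prems by auto
    obtain d0 where d0: "d0 > 0" "ball x d0 \<subseteq> \<Omega>" using op open_contains_ball by blast
    obtain d2 where d2: "d2 > 0" "\<And>y. y \<in> \<Omega> \<Longrightarrow> dist y x < d2 \<Longrightarrow> dist (D j y) (D j x) < e / 2"
      using cont[of j] op(2) insert.prems half_gt_zero[of e] unfolding continuous_on_iff by metis
    define \<delta> where "\<delta> = min d0 d2"
    \<comment> \<open>The part of \<open>h\<close> already moved has norm at most
      \<open>CARD('n) * norm h\<close>, and the new coordinate adds at most \<open>norm h\<close>;
      hence the divisor \<open>CARD('n) + 1\<close>.\<close>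
    define d where "d = min d1 (\<delta> / (real CARD('n) + 1))"
    have "d > 0" using d0 d1 d2 by (simp add: d_def \<delta>_def)
    moreover have "\<bar>f (x + (\<Sum>i\<in>insert j I. h $ i *\<^sub>R axis i 1)) - f x - (\<Sum>i\<in>insert j I. h $ i * D i x)\<bar> \<le> e * norm h"
      if h: "norm h < d" for h
    proof -
      define y where "y = x + (\<Sum>i\<in>I. h $ i *\<^sub>R axis i 1)"
      have near: "y + s *\<^sub>R axis j 1 \<in> \<Omega>" "dist (y + s *\<^sub>R axis j 1) x < d2" if "\<bar>s\<bar> \<le> \<bar>h $ j\<bar>" for s
      proof -
        have "dist (y + s *\<^sub>R axis j 1) x \<le> norm (\<Sum>i\<in>I. h $ i *\<^sub>R axis i (1::real)) + norm (s *\<^sub>R axis j (1::real))"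
          unfolding y_def dist_norm
          using norm_triangle_ineq[of "\<Sum>i\<in>I. h $ i *\<^sub>R axis i (1::real)" "s *\<^sub>R axis j (1::real)"]
          by (simp add: algebra_simps)
        also have "\<dots> \<le> real CARD('n) * norm h + norm h"
          using norm_part[of h I] that component_le_norm_cart[of h j] by (simp add: norm_axis_1)
        also have "\<dots> = (real CARD('n) + 1) * norm h" by (simp add: algebra_simps)
        also have "\<dots> < \<delta>"
          using h by (simp add: d_def pos_less_divide_eq add_pos_nonneg mult.commute)
        finally show "dist (y + s *\<^sub>R axis j 1) x < d2" "y + s *\<^sub>R axis j 1 \<in> \<Omega>"
          using d0(2) by (auto simp: \<delta>_def dist_commute)
      qed
      obtain \<xi> where \<xi>: "\<bar>\<xi>\<bar> \<le> \<bar>h $ j\<bar>" "f (y + (h $ j) *\<^sub>R axis j 1) - f y = h $ j * D j (y + \<xi> *\<^sub>R axis j 1)"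
        using partial_mvt[of "h $ j" f j "D j" y] D near(1) by blast
      have "\<bar>f (y + (h $ j) *\<^sub>R axis j 1) - f y - h $ j * D j x\<bar> = \<bar>h $ j\<bar> * \<bar>D j (y + \<xi> *\<^sub>R axis j 1) - D j x\<bar>"
        unfolding \<xi>(2) by (simp add: abs_mult flip: right_diff_distrib)
      also have "\<dots> \<le> norm h * (e / 2)"
        using d2(2)[OF near(1)[OF \<xi>(1)] near(2)[OF \<xi>(1)]] \<xi>(1) component_le_norm_cart[of h j]
        by (intro mult_mono) (auto simp: dist_real_def)
      finally have "\<bar>f (y + (h $ j) *\<^sub>R axis j 1) - f y - h $ j * D j x\<bar> \<le> e / 2 * norm h" by (simp add: mult.commute)
      moreover have "\<bar>f y - f x - (\<Sum>i\<in>I. h $ i * D i x)\<bar> \<le> e / 2 * norm h"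
        using d1(2)[of h] h by (simp add: d_def y_def)
      moreover have "x + (\<Sum>i\<in>insert j I. h $ i *\<^sub>R axis i 1) = y + (h $ j) *\<^sub>R axis j 1"
        "(\<Sum>i\<in>insert j I. h $ i * D i x) = (\<Sum>i\<in>I. h $ i * D i x) + h $ j * D j x"
        using insert.hyps by (simp_all add: y_def algebra_simps)
      ultimately show ?thesis by (simp, linarith)
    qed
    ultimately show ?case by blast
  qed
  have basis: "(\<Sum>i\<in>UNIV. h $ i *\<^sub>R axis i (1::real)) = h" for h :: "real^'n"
    using basis_expansion[of h] by (simp add: scalar_mult_eq_scaleR)
  have "bounded_linear (\<lambda>h. \<Sum>i\<in>UNIV. h $ i * D i x)"
    by (intro bounded_linear_sum bounded_linear_compose[OF bounded_linear_mult_left] bounded_linear_vec_nth)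
  moreover have "\<exists>d>0. \<forall>y. norm (y - x) < d \<longrightarrow>
      norm (f y - f x - (\<Sum>i\<in>UNIV. (y - x) $ i * D i x)) \<le> e * norm (y - x)" if "e > 0" for e
  proof -
    obtain d where d: "d > 0" "\<And>h. norm h < d \<Longrightarrow>
       \<bar>f (x + h) - f x - (\<Sum>i\<in>UNIV. h $ i * D i x)\<bar> \<le> e * norm h"
      using part[OF \<open>e > 0\<close>, of UNIV] unfolding basis by blast
    have "norm (f y - f x - (\<Sum>i\<in>UNIV. (y - x) $ i * D i x)) \<le> e * norm (y - x)" if "norm (y - x) < d" for y
      using d(2)[OF that] by simp
    with d(1) show ?thesis by blast
  qed
  ultimately show ?thesis unfolding has_derivative_at_alt by blast
qed

lemma has_real_derivative_along_line:
  fixes f :: "real^'n::finite \<Rightarrow> real"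
  assumes "open \<Omega>" "z + t *\<^sub>R h \<in> \<Omega>"
    and "\<And>i y. y \<in> \<Omega> \<Longrightarrow> has_partial f i (D i y) y"
    and "\<And>i. continuous_on \<Omega> (D i)"
  shows "((\<lambda>t. f (z + t *\<^sub>R h)) has_real_derivative (\<Sum>i\<in>UNIV. h $ i * D i (z + t *\<^sub>R h))) (at t)"
proof -
  have "((\<lambda>t. z + t *\<^sub>R h) has_derivative (\<lambda>s. s *\<^sub>R h)) (at t)"
    by (auto intro!: derivative_eq_intros)
  from has_derivative_compose[OF this has_derivative_of_continuous_partials[OF assms]]
  have "((\<lambda>t. f (z + t *\<^sub>R h)) has_derivative (\<lambda>s. \<Sum>i\<in>UNIV. (s *\<^sub>R h) $ i * D i (z + t *\<^sub>R h))) (at t)" .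
  then show ?thesis
    unfolding has_field_derivative_def
    by (rule has_derivative_eq_rhs) (auto simp: sum_distrib_left sum_distrib_right ac_simps)
qed

subsection \<open>Functions of class C^r\<close>

lemma Cr_partial:
  assumes "Cr r \<Omega> f" "length L < r" "x \<in> \<Omega>"
  shows "has_partial (pdl L f) i (pdl (i # L) f x) x"
  using assms unfolding Cr_def has_partial_def pdl_Cons pdiff_def
  by (auto simp: DERIV_deriv_iff_real_differentiable)

lemma Cr_continuous: "Cr r \<Omega> f \<Longrightarrow> length L \<le> r \<Longrightarrow> continuous_on \<Omega> (pdl L f)"
  by (simp add: Cr_def)

lemma Cr_mono: "Cr r \<Omega> f \<Longrightarrow> s \<le> r \<Longrightarrow> Cr s \<Omega> f"
  by (auto simp: Cr_def)

lemma pdiff_cong_open: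
  assumes "open \<Omega>" "x \<in> \<Omega>" "\<And>y. y \<in> \<Omega> \<Longrightarrow> f y = g y"
  shows "pdiff i f x = pdiff i g x"
proof -
  have "open ((\<lambda>t::real. x + t *\<^sub>R axis i 1) -` \<Omega>)"
    by (intro open_vimage assms continuous_intros)
  then have "\<forall>\<^sub>F t in nhds (0::real). x + t *\<^sub>R axis i 1 \<in> \<Omega>"
    using assms(2) unfolding eventually_nhds by (intro exI[of _ "(\<lambda>t. x + t *\<^sub>R axis i 1) -` \<Omega>"]) auto
  then have "\<forall>\<^sub>F t in nhds (0::real). f (x + t *\<^sub>R axis i 1) = g (x + t *\<^sub>R axis i 1)"
    by (rule eventually_mono) (use assms(3) in auto)
  then show ?thesis unfolding pdiff_def by (rule deriv_cong_ev) simp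
qed

lemma pdl_swap:
  assumes "open \<Omega>" "Cr r \<Omega> f" "length L + 2 \<le> r" "x \<in> \<Omega>"
  shows "pdl (i # j # L) f x = pdl (j # i # L) f x"
proof (rule mixed_partials_commute[OF assms(1,4), of "pdl L f" j "pdl (j # L) f" i "pdl (i # L) f"])
  show "has_partial (pdl L f) j (pdl (j # L) f y) y" "has_partial (pdl L f) i (pdl (i # L) f y) y"
    "has_partial (pdl (j # L) f) i (pdl (i # j # L) f y) y"
    "has_partial (pdl (i # L) f) j (pdl (j # i # L) f y) y" if "y \<in> \<Omega>" for y
    using assms(3) that by (auto intro!: Cr_partial[OF assms(2)] simp del: pdl_Cons)
  show "continuous_on \<Omega> (pdl (i # j # L) f)" "continuous_on \<Omega> (pdl (j # i # L) f)"
    using assms(3) by (auto intro!: Cr_continuous[OF assms(2)] simp del: pdl_Cons)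
qed

text \<open>The letter passes its left neighbours one by one. The induction hypothesis is used
  beneath a further derivative, so it has to hold throughout the open set and not only at
  \<open>x\<close>.\<close>

lemma pdl_move_to_front:
  assumes "open \<Omega>" "Cr r \<Omega> f" "length L + length M + 1 \<le> r" "x \<in> \<Omega>"
  shows "pdl (L @ i # M) f x = pdl (i # L @ M) f x"
  using assms(3,4)
proof (induction L arbitrary: x)
  case (Cons j L)
  have "pdl ((j # L) @ i # M) f x = pdl (j # i # L @ M) f x"
    using Cons pdiff_cong_open[OF assms(1) Cons.prems(2), of "pdl (L @ i # M) f" "pdl (i # L @ M) f" j] by simp
  also have "\<dots> = pdl (i # j # L @ M) f x"
    using Cons.prems by (intro pdl_swap[OF assms(1,2)]) auto
  finally show ?case by simp
qed simp

lemma pdl_eq_of_mset_eq: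
  assumes "open \<Omega>" "Cr r \<Omega> f" "length L \<le> r" "mset L = mset M" "x \<in> \<Omega>"
  shows "pdl L f x = pdl M f x"
  using assms(3-5)
proof (induction L arbitrary: M x)
  case (Cons i L)
  have "i \<in> set M" using Cons.prems(2) by (metis list.set_intros(1) set_mset_mset)
  then obtain M1 M2 where M: "M = M1 @ i # M2" by (meson split_list)
  have L: "mset L = mset (M1 @ M2)" using Cons.prems(2) M by simp
  then have len: "length L = length (M1 @ M2)" by (rule mset_eq_length)
  have "pdl (i # L) f x = pdl (i # M1 @ M2) f x"
    using Cons.IH[OF _ L] Cons.prems(1)
      pdiff_cong_open[OF assms(1) Cons.prems(3), of "pdl L f" "pdl (M1 @ M2) f" i] by simp
  also have "\<dots> = pdl M f x"
    unfolding M using Cons.prems len by (intro pdl_move_to_front[OF assms(1,2), symmetric]) auto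
  finally show ?case .
qed simp

text \<open>Makes the arbitrary choice of a word inside \<open>mdiff\<close> harmless.\<close>

lemma pdl_eq_mdiff:
  assumes "open \<Omega>" "Cr r \<Omega> f" "length L \<le> r" "x \<in> \<Omega>"
  shows "pdl L f x = mdiff (count_list L) f x"
  unfolding mdiff_mlist
  by (rule pdl_eq_of_mset_eq[OF assms(1-3) _ assms(4)]) (simp add: multiset_eq_iff count_mset)

subsection \<open>Taylor expansion\<close>

text \<open>Induction on \<open>r\<close>, with the hypothesis applied to the shifted sequence
  \<open>G (Suc m)\<close>. It bounds the derivative \<open>R'\<close> of the remainder
  \<open>R\<close> by \<open>B'\<close>, whose antiderivative vanishing at 0 is \<open>B\<close>;
  thus \<open>B - R\<close> and \<open>B + R\<close> both increase from 0. Each integration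
  contributes the next factor \<gamma> + i of the constant.\<close>

lemma taylor_holder_1d:
  fixes G :: "nat \<Rightarrow> real \<Rightarrow> real"
  assumes "\<And>m t. m < r \<Longrightarrow> 0 \<le> t \<Longrightarrow> t \<le> 1 \<Longrightarrow> (G m has_real_derivative G (Suc m) t) (at t)"
    and "\<And>t. 0 \<le> t \<Longrightarrow> t \<le> 1 \<Longrightarrow> \<bar>G r t - G r 0\<bar> \<le> K * t powr \<gamma>"
    and "0 < \<gamma>" "0 \<le> t" "t \<le> 1"
  shows "\<bar>G 0 t - (\<Sum>m\<le>r. G m 0 / fact m * t ^ m)\<bar> \<le> K / (\<Prod>i=1..r. \<gamma> + real i) * t powr (\<gamma> + real r)"
  using assms
proof (induction r arbitrary: G t)
  case 0
  then show ?case by simp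
next
  case (Suc r)
  define R where "R t = G 0 t - (\<Sum>m\<le>Suc r. G m 0 / fact m * t ^ m)" for t
  define R' where "R' t = G 1 t - (\<Sum>m\<le>r. G (Suc m) 0 / fact m * t ^ m)" for t
  define B where "B t = K / (\<Prod>i=1..Suc r. \<gamma> + real i) * t powr (\<gamma> + real (Suc r))" for t
  define B' where "B' t = K / (\<Prod>i=1..r. \<gamma> + real i) * t powr (\<gamma> + real r)" for t
  have pos: "\<gamma> + real (Suc r) > 0" using Suc.prems by simp
  have R'_le: "\<bar>R' s\<bar> \<le> B' s" if "0 \<le> s" "s \<le> 1" for s
    using Suc.IH[of "\<lambda>m. G (Suc m)" s] Suc.prems that unfolding R'_def B'_def by auto
  have dR: "(R has_real_derivative R' s) (at s)" if "0 \<le> s" "s \<le> 1" for s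
  proof -
    have "((\<lambda>t. \<Sum>m\<le>Suc r. G m 0 / fact m * t ^ m) has_real_derivative
        (\<Sum>m\<le>Suc r. G m 0 / fact m * (real m * s ^ (m - Suc 0)))) (at s)"
      by (intro DERIV_sum DERIV_cmult DERIV_pow)
    moreover have "(\<Sum>m\<le>Suc r. G m 0 / fact m * (real m * s ^ (m - Suc 0))) = (\<Sum>m\<le>r. G (Suc m) 0 / fact m * s ^ m)"
      by (subst sum.atMost_Suc_shift) (simp add: field_simps del: of_nat_Suc)
    ultimately show ?thesis
      unfolding R_def R'_def using Suc.prems(1)[of 0 s] that by (auto intro!: DERIV_diff)
  qed
  \<comment> \<open>Real powers are differentiated on the positive axis only. At 0, continuity of
    \<open>B\<close> is enough for the monotonicity criterion, which asks for derivatives in the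
    open interval.\<close>
  have dB: "(B has_real_derivative B' s) (at s)" if "0 < s" for s
  proof -
    have "((\<lambda>t. t powr (\<gamma> + real (Suc r))) has_real_derivative (\<gamma> + real (Suc r)) * s powr (\<gamma> + real (Suc r) - 1)) (at s)"
      using that by (rule has_real_derivative_powr)
    from DERIV_cmult[OF this, of "K / (\<Prod>i=1..Suc r. \<gamma> + real i)"] show ?thesis
      unfolding B_def B'_def
    proof (rule DERIV_cong)
      have eq: "\<gamma> + real (Suc r) - 1 = \<gamma> + real r" by simp
      show "K / (\<Prod>i=1..Suc r. \<gamma> + real i) * ((\<gamma> + real (Suc r)) * s powr (\<gamma> + real (Suc r) - 1))
          = K / (\<Prod>i=1..r. \<gamma> + real i) * s powr (\<gamma> + real r)"
        unfolding eq using pos by (simp del: of_nat_Suc)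
    qed
  qed
  have cR: "continuous_on {0..t} R"
    using DERIV_isCont[OF dR] Suc.prems(5) by (intro continuous_at_imp_continuous_on) auto
  have cB: "continuous_on {0..t} B"
    unfolding B_def using pos by (intro continuous_intros continuous_on_powr') auto
  have R0: "R 0 = 0"
    unfolding R_def by (subst sum.atMost_Suc_shift) simp
  have B0: "B 0 = 0" unfolding B_def by simp
  have "B 0 - R 0 \<le> B t - R t"
  proof (rule DERIV_nonneg_imp_increasing_open[OF Suc.prems(4)])
    fix s assume "0 < s" "s < t"
    then show "\<exists>y. ((\<lambda>t. B t - R t) has_real_derivative y) (at s) \<and> 0 \<le> y"
      using dB[of s] dR[of s] R'_le[of s] Suc.prems(5) by (intro exI[of _ "B' s - R' s"]) (auto intro: DERIV_diff)
  qed (intro continuous_intros cR cB)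
  moreover have "B 0 + R 0 \<le> B t + R t"
  proof (rule DERIV_nonneg_imp_increasing_open[OF Suc.prems(4)])
    fix s assume "0 < s" "s < t"
    then show "\<exists>y. ((\<lambda>t. B t + R t) has_real_derivative y) (at s) \<and> 0 \<le> y"
      using dB[of s] dR[of s] R'_le[of s] Suc.prems(5) by (intro exI[of _ "B' s + R' s"]) (auto intro: DERIV_add)
  qed (intro continuous_intros cR cB)
  ultimately have "\<bar>R t\<bar> \<le> B t" using R0 B0 by simp
  then show ?case unfolding R_def B_def .
qed

lemma segment_point:
  fixes z y :: "'a::real_vector"
  assumes "0 \<le> t" "t \<le> 1"
  shows "z + t *\<^sub>R (y - z) \<in> closed_segment z y"
  unfolding in_segment using assms by (intro exI[of _ t]) (simp add: algebra_simps)

text \<open>For smooth \<open>f\<close> this is the m-th derivative of t \<mapsto> f (z + t h),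
  expanded over words instead of multi-indices so that the next derivative just prepends a
  letter.\<close>

definition dirderiv :: "(real^'n::finite \<Rightarrow> real) \<Rightarrow> real^'n \<Rightarrow> real^'n \<Rightarrow> nat \<Rightarrow> real \<Rightarrow> real" where
  "dirderiv f z h m t = (\<Sum>L | length L = m. lpow h L * pdl L f (z + t *\<^sub>R h))"

lemma dirderiv_derivative:
  fixes f :: "real^'n::finite \<Rightarrow> real"
  assumes "open \<Omega>" "Cr r \<Omega> f" "m < r" "z + t *\<^sub>R h \<in> \<Omega>"
  shows "(dirderiv f z h m has_real_derivative dirderiv f z h (Suc m) t) (at t)"
proof -
  have "(dirderiv f z h m has_real_derivative
     (\<Sum>L | length L = m. lpow h L * (\<Sum>i\<in>UNIV. h $ i * pdl (i # L) f (z + t *\<^sub>R h)))) (at t)"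
    unfolding dirderiv_def
  proof (intro DERIV_sum DERIV_cmult)
    fix L :: "'n list" assume L: "L \<in> {L. length L = m}"
    show "((\<lambda>t. pdl L f (z + t *\<^sub>R h)) has_real_derivative (\<Sum>i\<in>UNIV. h $ i * pdl (i # L) f (z + t *\<^sub>R h))) (at t)"
      by (rule has_real_derivative_along_line[OF assms(1,4)])
        (use L assms(3) in \<open>auto intro!: Cr_partial[OF assms(2)] Cr_continuous[OF assms(2)] simp del: pdl_Cons\<close>)
  qed
  also have "(\<Sum>L | length L = m. lpow h L * (\<Sum>i\<in>UNIV. h $ i * pdl (i # L) f (z + t *\<^sub>R h)))
      = dirderiv f z h (Suc m) t"
    unfolding dirderiv_def sum_lists_Suc by (simp add: sum_distrib_left mult_ac)
  finally show ?thesis .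
qed

definition taylor_poly :: "nat \<Rightarrow> (real^'n::finite \<Rightarrow> real) \<Rightarrow> real^'n \<Rightarrow> real^'n \<Rightarrow> real" where
  "taylor_poly r f z y = (\<Sum>\<alpha> | mabs \<alpha> \<le> r. mdiff \<alpha> f z / mfact \<alpha> * (\<Prod>i\<in>UNIV. (y $ i - z $ i) ^ \<alpha> i))"

text \<open>Grouping the words of length m by letter counts yields the factor m!/\<alpha>!, whose
  numerator cancels against the 1/m! of the one-dimensional expansion.\<close>

lemma taylor_poly_dirderiv:
  assumes "open \<Omega>" "Cr r \<Omega> f" "z \<in> \<Omega>"
  shows "taylor_poly r f z (z + h) = (\<Sum>m\<le>r. dirderiv f z h m 0 / fact m)"
proof -
  have "dirderiv f z h m 0 = fact m * (\<Sum>\<alpha> | mabs \<alpha> = m. mdiff \<alpha> f z / mfact \<alpha> * (\<Prod>i\<in>UNIV. (h $ i) ^ \<alpha> i))"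
    if "m \<le> r" for m
  proof -
    have "dirderiv f z h m 0 = (\<Sum>L | length L = m. (\<Prod>i\<in>UNIV. (h $ i) ^ count_list L i) * mdiff (count_list L) f z)"
      unfolding dirderiv_def
      by (rule sum.cong) (use that assms in \<open>auto simp: lpow_prod pdl_eq_mdiff[OF assms(1,2) _ assms(3)]\<close>)
    also have "\<dots> = (\<Sum>\<alpha> | mabs \<alpha> = m. fact m / mfact \<alpha> * ((\<Prod>i\<in>UNIV. (h $ i) ^ \<alpha> i) * mdiff \<alpha> f z))"
      by (rule sum_lists_multinomial)
    finally show ?thesis by (simp add: sum_distrib_left mult_ac)
  qed
  then have "(\<Sum>m\<le>r. dirderiv f z h m 0 / fact m)
      = (\<Sum>m\<le>r. \<Sum>\<alpha> | mabs \<alpha> = m. mdiff \<alpha> f z / mfact \<alpha> * (\<Prod>i\<in>UNIV. (h $ i) ^ \<alpha> i))"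
    by simp
  also have "\<dots> = (\<Sum>m\<le>r. \<Sum>\<alpha>\<in>{\<alpha> \<in> {\<alpha>. mabs \<alpha> \<le> r}. mabs \<alpha> = m}. mdiff \<alpha> f z / mfact \<alpha> * (\<Prod>i\<in>UNIV. (h $ i) ^ \<alpha> i))"
    by (intro sum.cong refl) auto
  also have "\<dots> = taylor_poly r f z (z + h)"
    unfolding taylor_poly_def by (subst sum.group) auto
  finally show ?thesis by simp
qed

lemma taylor_bound:
  assumes "open \<Omega>" "Cr r \<Omega> f" "closed_segment z y \<subseteq> \<Omega>" "0 < \<gamma>"
    and "\<And>t. 0 \<le> t \<Longrightarrow> t \<le> 1 \<Longrightarrow>
      \<bar>dirderiv f z (y - z) r t - dirderiv f z (y - z) r 0\<bar> \<le> K * t powr \<gamma>"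
  shows "\<bar>f y - taylor_poly r f z y\<bar> \<le> K / (\<Prod>i=1..r. \<gamma> + real i)"
proof -
  define G where "G = dirderiv f z (y - z)"
  have in_\<Omega>: "z + t *\<^sub>R (y - z) \<in> \<Omega>" if "0 \<le> t" "t \<le> 1" for t
    using assms(3) that segment_point[of t z y] by auto
  have "\<bar>G 0 1 - (\<Sum>m\<le>r. G m 0 / fact m * 1 ^ m)\<bar> \<le> K / (\<Prod>i=1..r. \<gamma> + real i) * 1 powr (\<gamma> + real r)"
    by (rule taylor_holder_1d)
      (use assms(4,5) in_\<Omega> in \<open>auto simp: G_def intro!: dirderiv_derivative[OF assms(1,2)]\<close>)
  moreover have "G 0 1 = f y" by (simp add: G_def dirderiv_def)
  moreover have "taylor_poly r f z y = (\<Sum>m\<le>r. G m 0 / fact m)"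
    using taylor_poly_dirderiv[OF assms(1,2), of z "y - z"] in_\<Omega>[of 0] by (simp add: G_def)
  ultimately show ?thesis by simp
qed

lemma taylor_bound_holder:
  assumes "open \<Omega>" "Crgamma r \<gamma> \<Omega> f" "closed_segment z y \<subseteq> \<Omega>" "0 < \<gamma>"
  shows "\<bar>f y - taylor_poly r f z y\<bar> \<le> norm (y - z) powr (real r + \<gamma>) * Crgamma_semi r \<gamma> \<Omega> f"
\<comment> \<open>Hoelder quotients need two distinct points, which the segment offers only if
  \<open>y\<close> differs from \<open>z\<close>. Otherwise the remainder estimate is applied with
  \<open>K = 0\<close>.\<close>
proof (cases "y = z")
  case True
  have Cr: "Cr r \<Omega> f" using assms(2) by (simp add: Crgamma_def)
  have "\<bar>f y - taylor_poly r f z y\<bar> \<le> 0 / (\<Prod>i=1..r. \<gamma> + real i)"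
    by (rule taylor_bound[OF assms(1) Cr assms(3,4)]) (simp add: True dirderiv_def)
  then show ?thesis using True by simp
next
  case False
  define h where "h = y - z"
  have h: "norm h > 0" using False by (simp add: h_def)
  have Cr: "Cr r \<Omega> f" and bdd: "\<And>\<alpha>. mabs \<alpha> = r \<Longrightarrow> holder_bdd \<gamma> \<Omega> (mdiff \<alpha> f)"
    using assms(2) by (auto simp: Crgamma_def)
  have in_\<Omega>: "z + t *\<^sub>R h \<in> \<Omega>" if "0 \<le> t" "t \<le> 1" for t
    using assms(3) that segment_point[of t z y] by (auto simp: h_def)
  have z: "z \<in> \<Omega>" using assms(3) by auto
  define S where "S = sqrt (\<Sum>\<alpha>::'a \<Rightarrow> nat | mabs \<alpha> = r. fact r / mfact \<alpha> * (holder_semi \<gamma> \<Omega> (mdiff \<alpha> f))\<^sup>2)"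
  have "\<bar>f y - taylor_poly r f z y\<bar> \<le> (norm h ^ r * S * norm h powr \<gamma>) / (\<Prod>i=1..r. \<gamma> + real i)"
  proof (rule taylor_bound[OF assms(1) Cr assms(3,4), folded h_def])
    fix t :: real assume t: "0 \<le> t" "t \<le> 1"
    show "\<bar>dirderiv f z h r t - dirderiv f z h r 0\<bar> \<le> norm h ^ r * S * norm h powr \<gamma> * t powr \<gamma>"
    proof (cases "t = 0")
      case False
      \<comment> \<open>The distance of the two points on the segment, raised to the power \<gamma>.
        After division by it, each \<open>a L\<close> is up to sign a quotient of the set whose
        supremum is \<open>holder_semi\<close>.\<close>
      define d where "d = (t * norm h) powr \<gamma>"
      have d: "d > 0" using False t h by (simp add: d_def)
      define a where "a L = (pdl L f (z + t *\<^sub>R h) - pdl L f z) / d" for L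
      have a: "\<bar>a L\<bar> \<le> holder_semi \<gamma> \<Omega> (mdiff (count_list L) f)" if L: "length L = r" for L
      proof -
        let ?g = "mdiff (count_list L) f"
        have "\<bar>a L\<bar> = \<bar>?g (z + t *\<^sub>R h) - ?g z\<bar> / norm (z + t *\<^sub>R h - z) powr \<gamma>"
          using pdl_eq_mdiff[OF assms(1) Cr, of L] L z in_\<Omega>[OF t] d t by (simp add: a_def d_def)
        also have "\<dots> \<le> holder_semi \<gamma> \<Omega> ?g"
          unfolding holder_semi_def
        proof (rule cSup_upper)
          show "bdd_above {\<bar>?g x - ?g y\<bar> / norm (x - y) powr \<gamma> |x y. x \<in> \<Omega> \<and> y \<in> \<Omega> \<and> x \<noteq> y}"
            using bdd[of "count_list L"] L by (simp add: holder_bdd_def)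
          show "\<bar>?g (z + t *\<^sub>R h) - ?g z\<bar> / norm (z + t *\<^sub>R h - z) powr \<gamma>
              \<in> {\<bar>?g x - ?g y\<bar> / norm (x - y) powr \<gamma> |x y. x \<in> \<Omega> \<and> y \<in> \<Omega> \<and> x \<noteq> y}"
            using z in_\<Omega>[OF t] False h by (intro CollectI exI[of _ "z + t *\<^sub>R h"] exI[of _ z]) auto
        qed
        finally show ?thesis .
      qed
      have "dirderiv f z h r t - dirderiv f z h r 0 = d * (\<Sum>L | length L = r. lpow h L * a L)"
      proof -
        have "d * (lpow h L * a L) = lpow h L * pdl L f (z + t *\<^sub>R h) - lpow h L * pdl L f z" for L
          using d by (simp add: a_def field_simps)
        then show ?thesis by (simp add: dirderiv_def sum_distrib_left sum_subtractf)
      qed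
      also have "\<bar>\<dots>\<bar> = d * \<bar>\<Sum>L | length L = r. lpow h L * a L\<bar>"
        using d by (simp add: abs_mult)
      also have "\<dots> \<le> d * (norm h ^ r * S)"
        unfolding S_def using d
        by (intro mult_left_mono sum_lpow_le[of r a "\<lambda>\<alpha>. holder_semi \<gamma> \<Omega> (mdiff \<alpha> f)"] a) auto
      finally show ?thesis using t by (simp add: d_def powr_mult mult_ac)
    qed simp
  qed
  also have "\<dots> = norm h powr (real r + \<gamma>) * Crgamma_semi r \<gamma> \<Omega> f"
    using h by (simp add: Crgamma_semi_def S_def powr_add powr_realpow)
  finally show ?thesis by (simp add: h_def)
qed

text \<open>The case \<gamma> = 1: by the mean value theorem the directional derivative of order
  \<open>r\<close> is Lipschitz in \<open>t\<close>, with the bound on order \<open>Suc r\<close> as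
  its constant. Bounds are asked for on the segment only, since mollified functions are controlled
  only on a compact part of \<Omega>.\<close>

lemma taylor_bound_derivative:
  assumes "open \<Omega>" "Cr (Suc r) \<Omega> f" "closed_segment z y \<subseteq> \<Omega>"
    and "\<And>\<alpha> u. mabs \<alpha> = Suc r \<Longrightarrow> u \<in> closed_segment z y \<Longrightarrow> \<bar>mdiff \<alpha> f u\<bar> \<le> B \<alpha>"
  shows "\<bar>f y - taylor_poly r f z y\<bar> \<le> norm (y - z) ^ Suc r *
    (1 / fact (Suc r) * sqrt (\<Sum>\<alpha> | mabs \<alpha> = Suc r. fact (Suc r) / mfact \<alpha> * (B \<alpha>)\<^sup>2))"
proof -
  define h where "h = y - z"
  have in_seg: "z + t *\<^sub>R h \<in> closed_segment z y" if "0 \<le> t" "t \<le> 1" for t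
    using that segment_point[of t z y] by (auto simp: h_def)
  define S where "S = sqrt (\<Sum>\<alpha> | mabs \<alpha> = Suc r. fact (Suc r) / mfact \<alpha> * (B \<alpha>)\<^sup>2)"
  have bound: "\<bar>dirderiv f z h (Suc r) t\<bar> \<le> norm h ^ Suc r * S" if "0 \<le> t" "t \<le> 1" for t
    unfolding dirderiv_def S_def
  proof (rule sum_lpow_le)
    fix L :: "'a list" assume "length L = Suc r"
    then show "\<bar>pdl L f (z + t *\<^sub>R h)\<bar> \<le> B (count_list L)"
      using in_seg[OF that] assms(3) assms(4)[of "count_list L" "z + t *\<^sub>R h"]
        pdl_eq_mdiff[OF assms(1,2), of L "z + t *\<^sub>R h"] by auto
  qed
  have "\<bar>f y - taylor_poly r f z y\<bar> \<le> (norm h ^ Suc r * S) / (\<Prod>i=1..r. 1 + real i)"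
  proof (rule taylor_bound[OF assms(1) Cr_mono[OF assms(2)] assms(3), folded h_def])
    fix t :: real assume t: "0 \<le> t" "t \<le> 1"
    show "\<bar>dirderiv f z h r t - dirderiv f z h r 0\<bar> \<le> norm h ^ Suc r * S * t powr 1"
    proof (cases "t = 0")
      case False
      have "\<exists>\<xi>>0. \<xi> < t \<and> dirderiv f z h r t - dirderiv f z h r 0 = (t - 0) * dirderiv f z h (Suc r) \<xi>"
        by (rule MVT2) (use False t in_seg assms(3) in \<open>auto intro!: dirderiv_derivative[OF assms(1,2)]\<close>)
      then obtain \<xi> where "0 < \<xi>" "\<xi> < t" "dirderiv f z h r t - dirderiv f z h r 0 = t * dirderiv f z h (Suc r) \<xi>"
        by auto
      then show ?thesis
        using bound[of \<xi>] t mult_left_mono[OF bound[of \<xi>], of t] by (simp add: abs_mult mult_ac)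
    qed simp
  qed simp_all
  also have "(\<Prod>i=1..r. 1 + real i) = fact (Suc r)"
    by (induction r) (simp_all add: algebra_simps)
  finally show ?thesis by (simp add: S_def h_def)
qed

subsection \<open>Polynomials\<close>

lemma polysI: "p = (\<lambda>y. \<Sum>\<alpha> | mabs \<alpha> < q. b \<alpha> * (\<Prod>i\<in>UNIV. (y $ i) ^ \<alpha> i)) \<Longrightarrow> p \<in> polys q"
  unfolding polys_def by blast

lemma polys_add:
  assumes "p \<in> polys q" "p' \<in> polys q"
  shows "(\<lambda>y. p y + p' y) \<in> polys q"
proof -
  obtain b b' where "p = (\<lambda>y. \<Sum>\<alpha> | mabs \<alpha> < q. b \<alpha> * (\<Prod>i\<in>UNIV. (y $ i) ^ \<alpha> i))"
    "p' = (\<lambda>y. \<Sum>\<alpha> | mabs \<alpha> < q. b' \<alpha> * (\<Prod>i\<in>UNIV. (y $ i) ^ \<alpha> i))"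
    using assms unfolding polys_def by blast
  then show ?thesis
    by (intro polysI[where q = q and b = "\<lambda>\<alpha>. b \<alpha> + b' \<alpha>"]) (simp add: sum.distrib distrib_right)
qed

lemma polys_cmult:
  assumes "p \<in> polys q"
  shows "(\<lambda>y. a * p y) \<in> polys q"
proof -
  obtain b where "p = (\<lambda>y. \<Sum>\<alpha> | mabs \<alpha> < q. b \<alpha> * (\<Prod>i\<in>UNIV. (y $ i) ^ \<alpha> i))"
    using assms unfolding polys_def by blast
  then show ?thesis
    by (intro polysI[where q = q and b = "\<lambda>\<alpha>. a * b \<alpha>"]) (simp add: sum_distrib_left mult.assoc)
qed

lemma polys_zero: "(\<lambda>y. 0) \<in> polys q"
  by (rule polysI[where q = q and b = "\<lambda>_. 0"]) simp

lemma polys_diff: "p \<in> polys q \<Longrightarrow> p' \<in> polys q \<Longrightarrow> (\<lambda>y. p y - p' y) \<in> polys q"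
  using polys_add[of p q "\<lambda>y. (-1) * p' y"] polys_cmult[of p' q "-1"] by simp

lemma polys_sum: "(\<And>a. a \<in> A \<Longrightarrow> p a \<in> polys q) \<Longrightarrow> (\<lambda>y. \<Sum>a\<in>A. p a y) \<in> polys q"
  by (induction A rule: infinite_finite_induct) (auto simp: polys_zero intro: polys_add)

lemma polys_monomial: "mabs \<alpha> < q \<Longrightarrow> (\<lambda>y. \<Prod>i\<in>UNIV. (y $ i) ^ \<alpha> i) \<in> polys q"
  by (rule polysI[where q = q and b = "\<lambda>\<beta>. if \<beta> = \<alpha> then 1 else 0"]) (simp add: if_distrib[of "\<lambda>t. t * _"] sum.delta cong: if_cong)

lemma polys_mono:
  assumes "p \<in> polys q" "q \<le> q'"
  shows "p \<in> polys q'"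
proof -
  obtain b where "p = (\<lambda>y. \<Sum>\<alpha> | mabs \<alpha> < q. b \<alpha> * (\<Prod>i\<in>UNIV. (y $ i) ^ \<alpha> i))"
    using assms unfolding polys_def by blast
  then show ?thesis using assms(2) by (auto intro!: polys_sum polys_cmult polys_monomial)
qed

lemma polys_mult_coordinate:
  fixes p :: "real^'n::finite \<Rightarrow> real"
  assumes "p \<in> polys q"
  shows "(\<lambda>y. y $ j * p y) \<in> polys (Suc q)"
proof -
  obtain b where p: "p = (\<lambda>y. \<Sum>\<alpha> | mabs \<alpha> < q. b \<alpha> * (\<Prod>i\<in>UNIV. (y $ i) ^ \<alpha> i))"
    using assms unfolding polys_def by blast
  have "(\<lambda>y. \<Sum>\<alpha> | mabs \<alpha> < q. b \<alpha> * (\<Prod>i\<in>UNIV. (y $ i) ^ (count_list (j # mlist \<alpha>)) i)) \<in> polys (Suc q)"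
    by (intro polys_sum polys_cmult polys_monomial) (simp del: count_list.simps)
  moreover have "(\<Prod>i\<in>UNIV. (y $ i) ^ (count_list (j # mlist \<alpha>)) i) = y $ j * (\<Prod>i\<in>UNIV. (y $ i) ^ \<alpha> i)"
    for y :: "real^'n" and \<alpha>
    using lpow_prod[of y "j # mlist \<alpha>"] lpow_prod[of y "mlist \<alpha>"] by simp
  ultimately show ?thesis unfolding p by (simp add: sum_distrib_left mult.left_commute del: count_list.simps)
qed

text \<open>\<open>polys\<close> is written in monomials centred at 0, Taylor polynomials in
  monomials centred at \<open>z\<close>. Multiplying by one factor \<open>y $ j - z $ j\<close> per
  letter of the word raises the degree bound by one each time.\<close>

lemma polys_shifted_monomial: "mabs \<alpha> < q \<Longrightarrow> (\<lambda>y. \<Prod>i\<in>UNIV. (y $ i - z $ i) ^ \<alpha> i) \<in> polys q"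
proof -
  have *: "(\<lambda>y. lpow (y - z) L) \<in> polys (Suc (length L))" for L
  proof (induction L)
    case Nil
    have "(\<lambda>y. \<Prod>i\<in>UNIV. (y $ i) ^ (\<lambda>_. 0 :: nat) i) \<in> polys (Suc 0)"
      by (rule polys_monomial) (simp add: mabs_def)
    then show ?case by simp
  next
    case (Cons j L)
    have "(\<lambda>y. y $ j * lpow (y - z) L - z $ j * lpow (y - z) L) \<in> polys (Suc (length (j # L)))"
      using polys_mult_coordinate[OF Cons, of j] polys_mono[OF Cons] by (auto intro!: polys_diff polys_cmult)
    then show ?case by (simp add: left_diff_distrib)
  qed
  assume "mabs \<alpha> < q"
  then show ?thesis
    using polys_mono[OF *[of "mlist \<alpha>"], of q] by (simp add: lpow_prod)
qed

lemma taylor_poly_in_polys: "r < q \<Longrightarrow> taylor_poly r f z \<in> polys q"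
  unfolding taylor_poly_def[abs_def] by (intro polys_sum polys_cmult polys_shifted_monomial) auto

lemma mdiff_taylor_poly:
  fixes z :: "real^'n::finite"
  assumes "mabs \<alpha> \<le> r"
  shows "mdiff \<alpha> (taylor_poly r f z) z = mdiff \<alpha> f z"
proof -
  \<comment> \<open>The m-th derivative of \<open>(t - z $ i) ^ \<beta> i\<close> with its falling
    factorial. For \<open>m > \<beta> i\<close> the truncated exponent is 0, but the product then
    contains the factor 0. At \<open>z $ i\<close> only \<open>m = \<beta> i\<close> survives, with
    value m!.\<close>
  define F where "F \<beta> i m t = (\<Prod>l<m. real (\<beta> i) - real l) * (t - z $ i) ^ (\<beta> i - m)"
    for \<beta> :: "'n \<Rightarrow> nat" and i m t
  have F: "(F \<beta> i m has_real_derivative F \<beta> i (Suc m) t) (at t)" for \<beta> i m t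
  proof (cases "m < \<beta> i")
    case True
    have "((\<lambda>t. (t - z $ i) ^ (\<beta> i - m)) has_real_derivative
        real (\<beta> i - m) * (t - z $ i) ^ (\<beta> i - m - 1) * 1) (at t)"
      by (rule derivative_eq_intros refl | simp)+
    from DERIV_cmult[OF this, of "\<Prod>l<m. real (\<beta> i) - real l"] True show ?thesis
      unfolding F_def by (simp add: of_nat_diff mult_ac)
  next
    case False
    then have "F \<beta> i m = (\<lambda>_. \<Prod>l<m. real (\<beta> i) - real l)" "F \<beta> i (Suc m) t = 0"
      by (auto simp: F_def)
    then show ?thesis by simp
  qed
  have F_at: "F \<beta> i m (z $ i) = (if \<beta> i = m then fact m else 0)" for \<beta> i m
  proof -
    have fact: "(\<Prod>l<n. real n - real l) = fact n" for n
    proof -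
      have "(\<Prod>l<n. real n - real l) = (\<Prod>l<n. real (Suc l))"
        by (rule prod.reindex_bij_witness[of _ "\<lambda>l. n - Suc l" "\<lambda>l. n - Suc l"]) (auto simp: of_nat_diff)
      also have "\<dots> = fact n" by (simp add: fact_prod_Suc atLeast0LessThan)
      finally show ?thesis .
    qed
    show ?thesis
    proof (cases "\<beta> i" m rule: linorder_cases)
      case equal
      then show ?thesis by (simp add: F_def fact)
    qed (auto simp: F_def)
  qed
  have "taylor_poly r f z = sum_prod {\<beta>. mabs \<beta> \<le> r} (\<lambda>\<beta>. mdiff \<beta> f z / mfact \<beta>) F []"
    by (simp add: fun_eq_iff taylor_poly_def sum_prod_def F_def)
  then have "mdiff \<alpha> (taylor_poly r f z) z = sum_prod {\<beta>. mabs \<beta> \<le> r} (\<lambda>\<beta>. mdiff \<beta> f z / mfact \<beta>) F (mlist \<alpha>) z"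
    unfolding mdiff_mlist using sum_prod_pdl[of F, OF F] by simp
  also have "\<dots> = (\<Sum>\<beta> | mabs \<beta> \<le> r. mdiff \<beta> f z / mfact \<beta> * (\<Prod>i\<in>UNIV. if \<beta> i = \<alpha> i then fact (\<alpha> i) else 0))"
    unfolding sum_prod_def F_at count_mlist ..
  also have "\<dots> = (\<Sum>\<beta> | mabs \<beta> \<le> r. if \<beta> = \<alpha> then mdiff \<alpha> f z else 0)"
  proof (rule sum.cong)
    fix \<beta> :: "'n \<Rightarrow> nat"
    show "mdiff \<beta> f z / mfact \<beta> * (\<Prod>i\<in>UNIV. if \<beta> i = \<alpha> i then fact (\<alpha> i) else 0) = (if \<beta> = \<alpha> then mdiff \<alpha> f z else 0)"
    proof (cases "\<beta> = \<alpha>")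
      case True
      then show ?thesis by (simp add: mfact_def)
    next
      case False
      then obtain i where "\<beta> i \<noteq> \<alpha> i" by auto
      then have "(\<Prod>i\<in>UNIV. if \<beta> i = \<alpha> i then fact (\<alpha> i) else 0 :: real) = 0"
        by (intro prod_zero) auto
      then show ?thesis using False by simp
    qed
  qed simp
  also have "\<dots> = mdiff \<alpha> f z" using assms by (simp add: sum.delta)
  finally show ?thesis .
qed

lemma Dop_taylor_poly: "k \<le> r \<Longrightarrow> Dop k c (taylor_poly r f z) z = Dop k c f z"
  unfolding Dop_def by (rule sum.cong) (auto simp: mdiff_taylor_poly)

subsection \<open>Weighted least squares\<close>

definition wip :: "nat \<Rightarrow> (nat \<Rightarrow> real) \<Rightarrow> (nat \<Rightarrow> real) \<Rightarrow> (nat \<Rightarrow> real) \<Rightarrow> real" where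
  "wip N \<theta> u v = (\<Sum>j<N. \<theta> j * (u j * v j))"

lemma wip_add: "wip N \<theta> u (\<lambda>j. v j + w j) = wip N \<theta> u v + wip N \<theta> u w"
  and wip_cmult: "wip N \<theta> u (\<lambda>j. a * v j) = a * wip N \<theta> u v"
  and wip_diff: "wip N \<theta> u (\<lambda>j. v j - w j) = wip N \<theta> u v - wip N \<theta> u w"
  by (simp_all add: wip_def algebra_simps sum.distrib sum_subtractf sum_distrib_left)

context
  fixes q N :: nat and \<theta> :: "nat \<Rightarrow> real" and x :: "nat \<Rightarrow> real^'n::finite"
  assumes unisolv: "unisolvent q N x" and theta_pos: "\<And>j. j < N \<Longrightarrow> \<theta> j > 0"
begin

lemma wip_self_zero:
  assumes "wip N \<theta> u u = 0" "j < N"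
  shows "u j = 0"
proof -
  have "\<forall>j\<in>{..<N}. \<theta> j * (u j * u j) = 0"
    using assms(1) theta_pos unfolding wip_def
    by (subst (asm) sum_nonneg_eq_0_iff) (auto intro!: mult_nonneg_nonneg simp: less_imp_le)
  then show ?thesis using assms(2) theta_pos[of j] by force
qed

lemma exists_projection:
  assumes "finite A" "A \<subseteq> polys q"
  shows "\<exists>p\<in>polys q. \<forall>a\<in>A. wip N \<theta> (\<lambda>j. v j - p (x j)) (\<lambda>j. a (x j)) = 0"
proof -
  \<comment> \<open>Gram-Schmidt; the last conjunct keeps the projection orthogonal to whatever is orthogonal to \<open>A\<close>.\<close>
  have "\<exists>p\<in>polys q. (\<forall>a\<in>A. wip N \<theta> (\<lambda>j. v j - p (x j)) (\<lambda>j. a (x j)) = 0) \<and>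
      (\<forall>u. (\<forall>a\<in>A. wip N \<theta> u (\<lambda>j. a (x j)) = 0) \<longrightarrow> wip N \<theta> u (\<lambda>j. p (x j)) = 0)"
    using assms
  proof (induction A arbitrary: v rule: finite_induct)
    case empty
    then show ?case using polys_zero by (auto simp: wip_def intro!: bexI[of _ "\<lambda>_. 0"])
  next
    case (insert a A)
    obtain p where p: "p \<in> polys q" "\<And>b. b \<in> A \<Longrightarrow> wip N \<theta> (\<lambda>j. v j - p (x j)) (\<lambda>j. b (x j)) = 0"
      "\<And>u. (\<forall>a\<in>A. wip N \<theta> u (\<lambda>j. a (x j)) = 0) \<Longrightarrow> wip N \<theta> u (\<lambda>j. p (x j)) = 0"
      using insert.IH[of v] insert.prems by auto
    obtain p' where p': "p' \<in> polys q" "\<And>b. b \<in> A \<Longrightarrow> wip N \<theta> (\<lambda>j. a (x j) - p' (x j)) (\<lambda>j. b (x j)) = 0"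
      "\<And>u. (\<forall>a\<in>A. wip N \<theta> u (\<lambda>j. a (x j)) = 0) \<Longrightarrow> wip N \<theta> u (\<lambda>j. p' (x j)) = 0"
      using insert.IH[of "\<lambda>j. a (x j)"] insert.prems by auto
    define a' where "a' y = a y - p' y" for y
    have a': "a' \<in> polys q" unfolding a'_def[abs_def] using insert.prems p'(1) by (intro polys_diff) auto
    let ?x = "\<lambda>f j. f (x j)"
    \<comment> \<open>If \<open>a'\<close> vanishes at all nodes the denominator is 0, so that
      \<open>s = 0\<close> by convention, and orthogonality to \<open>a'\<close> is trivial.\<close>
    define s where "s = wip N \<theta> (\<lambda>j. v j - p (x j)) (?x a') / wip N \<theta> (?x a') (?x a')"
    define P where "P y = p y + s * a' y" for y
    have P: "P \<in> polys q" unfolding P_def[abs_def] using p(1) a' by (intro polys_add polys_cmult)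
    have a'A: "wip N \<theta> (?x a') (?x b) = 0" if "b \<in> A" for b
      using p'(2)[OF that] by (simp add: a'_def)
    have res: "wip N \<theta> (\<lambda>j. v j - P (x j)) u = wip N \<theta> (\<lambda>j. v j - p (x j)) u - s * wip N \<theta> (?x a') u" for u
      by (simp add: P_def wip_def algebra_simps sum.distrib sum_subtractf sum_distrib_left)
    have PA: "wip N \<theta> (\<lambda>j. v j - P (x j)) (?x b) = 0" if "b \<in> A" for b
      unfolding res using p(2)[OF that] a'A[OF that] by simp
    have Pa': "wip N \<theta> (\<lambda>j. v j - P (x j)) (?x a') = 0"
    proof (cases "wip N \<theta> (?x a') (?x a') = 0")
      case True
      then show ?thesis using wip_self_zero[OF True] by (simp add: wip_def)
    next
      case False
      then show ?thesis unfolding res s_def by simp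
    qed
    have "wip N \<theta> (\<lambda>j. v j - P (x j)) (?x a) = 0"
    proof -
      have "wip N \<theta> (\<lambda>j. v j - P (x j)) (?x p') = 0" using p'(3) PA by blast
      then show ?thesis
        using Pa' unfolding a'_def by (simp add: wip_diff)
    qed
    moreover have "wip N \<theta> u (?x P) = 0" if "\<forall>a\<in>insert a A. wip N \<theta> u (\<lambda>j. a (x j)) = 0" for u
    proof -
      have "wip N \<theta> u (?x p) = 0" "wip N \<theta> u (?x p') = 0" "wip N \<theta> u (?x a) = 0"
        using p(3)[of u] p'(3)[of u] that by auto
      then show ?thesis unfolding P_def a'_def by (simp add: wip_add wip_cmult wip_diff)
    qed
    ultimately show ?case using P PA by (intro bexI[of _ P]) auto
  qed
  then show ?thesis by blast
qed

lemma exists_lsq: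
  obtains p where "p \<in> polys q" "\<And>p'. p' \<in> polys q \<Longrightarrow> wip N \<theta> (\<lambda>j. v j - p (x j)) (\<lambda>j. p' (x j)) = 0"
proof -
  define A where "A = (\<lambda>\<alpha> (y::real^'n). \<Prod>i\<in>UNIV. (y $ i) ^ \<alpha> i) ` {\<alpha>. mabs \<alpha> < q}"
  have "finite A" "A \<subseteq> polys q" unfolding A_def using polys_monomial by auto
  then obtain p where p: "p \<in> polys q" "\<And>a. a \<in> A \<Longrightarrow> wip N \<theta> (\<lambda>j. v j - p (x j)) (\<lambda>j. a (x j)) = 0"
    using exists_projection[of A v] by blast
  have "wip N \<theta> (\<lambda>j. v j - p (x j)) (\<lambda>j. p' (x j)) = 0" if "p' \<in> polys q" for p'
  proof -
    obtain b where p': "p' = (\<lambda>y. \<Sum>\<alpha> | mabs \<alpha> < q. b \<alpha> * (\<Prod>i\<in>UNIV. (y $ i) ^ \<alpha> i))"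
      using \<open>p' \<in> polys q\<close> unfolding polys_def by blast
    have sum: "wip N \<theta> u (\<lambda>j. \<Sum>\<alpha>\<in>I. g \<alpha> j) = (\<Sum>\<alpha>\<in>I. wip N \<theta> u (g \<alpha>))" for u g and I :: "('n \<Rightarrow> nat) set"
      unfolding wip_def sum_distrib_left by (rule sum.swap)
    have "wip N \<theta> (\<lambda>j. v j - p (x j)) (\<lambda>j. \<Prod>i\<in>UNIV. (x j $ i) ^ \<alpha> i) = 0" if "mabs \<alpha> < q" for \<alpha>
      using p(2)[of "\<lambda>y. \<Prod>i\<in>UNIV. (y $ i) ^ \<alpha> i"] that by (auto simp: A_def)
    then show ?thesis unfolding p' sum wip_cmult by simp
  qed
  with p(1) show ?thesis using that by blast
qed

text \<open>Orthogonality turns \<open>E p' - E p\<close> into the weighted squared distance of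
  \<open>p'\<close> and \<open>p\<close> at the nodes. A second minimizer therefore agrees with
  \<open>p\<close> at the nodes, and unisolvence supplies the uniqueness that \<open>THE\<close>
  requires.\<close>

lemma lsq_characterization:
  assumes p: "p \<in> polys q" and orth: "\<And>p'. p' \<in> polys q \<Longrightarrow> wip N \<theta> (\<lambda>j. v j - p (x j)) (\<lambda>j. p' (x j)) = 0"
  shows "lsq q N \<theta> x v = p"
proof -
  define E where "E p = (\<Sum>j<N. \<theta> j * (p (x j) - v j)\<^sup>2)" for p
  have pythagoras: "E p' = E p + wip N \<theta> (\<lambda>j. p' (x j) - p (x j)) (\<lambda>j. p' (x j) - p (x j))" if "p' \<in> polys q" for p'
  proof -
    have "E p' = E p + wip N \<theta> (\<lambda>j. p' (x j) - p (x j)) (\<lambda>j. p' (x j) - p (x j))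
        - 2 * wip N \<theta> (\<lambda>j. v j - p (x j)) (\<lambda>j. p' (x j) - p (x j))"
      unfolding E_def wip_def sum_distrib_left sum.distrib[symmetric] sum_subtractf[symmetric]
      by (rule sum.cong) (auto simp: power2_eq_square algebra_simps)
    then show ?thesis using orth[OF polys_diff[OF that p]] by simp
  qed
  have nonneg: "wip N \<theta> u u \<ge> 0" for u
    unfolding wip_def using theta_pos by (intro sum_nonneg) (simp add: less_imp_le)
  show ?thesis
    unfolding lsq_def E_def[symmetric]
  proof (rule the_equality)
    show "p \<in> polys q \<and> (\<forall>p'\<in>polys q. E p \<le> E p')"
    proof (intro conjI ballI p)
      fix p' :: "real^'n \<Rightarrow> real" assume "p' \<in> polys q"
      then show "E p \<le> E p'"
        using pythagoras[of p'] nonneg[of "\<lambda>j. p' (x j) - p (x j)"] by linarith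
    qed
  next
    fix p' assume p': "p' \<in> polys q \<and> (\<forall>p''\<in>polys q. E p' \<le> E p'')"
    then have "E p' \<le> E p" using p by blast
    then have "wip N \<theta> (\<lambda>j. p' (x j) - p (x j)) (\<lambda>j. p' (x j) - p (x j)) = 0"
      using pythagoras[OF conjunct1[OF p']] nonneg[of "\<lambda>j. p' (x j) - p (x j)"] by linarith
    then have "\<forall>j<N. p' (x j) - p (x j) = 0" using wip_self_zero by blast
    then have "(\<lambda>y. p' y - p y) = (\<lambda>_. 0)"
      using bspec[OF unisolv[unfolded unisolvent_def] polys_diff[OF conjunct1[OF p'] p]] by simp
    then show "p' = p" by (auto simp: fun_eq_iff)
  qed
qed

lemma lsq_poly: "p \<in> polys q \<Longrightarrow> lsq q N \<theta> x (\<lambda>j. p (x j)) = p"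
  by (rule lsq_characterization) (auto simp: wip_def)

lemma lsq_weights_exact:
  assumes "\<And>v. Dop k c (lsq q N \<theta> x v) z = (\<Sum>j<N. w j * v j)"
  shows "exact_weights q k c z N x w"
  unfolding exact_weights_def using assms lsq_poly by metis

text \<open>The weights are tested on their own representer \<open>v\<close>. Its fit
  \<open>p\<close> satisfies \<open>W = Dop k c p z\<close>, which equals the sum of
  \<open>u j * p (x j)\<close> for every exact \<open>u\<close>. Exactness of \<open>w\<close> and
  orthogonality of the residual show that the weighted squared norm of \<open>p\<close> is
  \<open>W\<close> as well. Cauchy-Schwarz then gives \<open>W\<^sup>2 \<le> U * W\<close>.\<close>

lemma lsq_weights_minimal:
  assumes w: "\<And>v. Dop k c (lsq q N \<theta> x v) z = (\<Sum>j<N. w j * v j)"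
    and u: "exact_weights q k c z N x u"
  shows "sqrt (\<Sum>j<N. (w j)\<^sup>2 / \<theta> j) \<le> sqrt (\<Sum>j<N. (u j)\<^sup>2 / \<theta> j)"
proof -
  \<comment> \<open>Chosen so that the weighted inner product with \<open>v\<close> is the plain sum
    against \<open>w\<close>.\<close>
  define v where "v j = w j / \<theta> j" for j
  obtain p where p: "p \<in> polys q" "\<And>p'. p' \<in> polys q \<Longrightarrow> wip N \<theta> (\<lambda>j. v j - p (x j)) (\<lambda>j. p' (x j)) = 0"
    using exists_lsq by blast
  have nw: "(\<Sum>j<N. (w j)\<^sup>2 / \<theta> j) = (\<Sum>j<N. w j * v j)"
    by (simp add: v_def power2_eq_square)
  have "(\<Sum>j<N. w j * v j) = Dop k c p z"
    using w[of v] lsq_characterization[OF p] by simp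
  also have "\<dots> = (\<Sum>j<N. u j * p (x j))"
    using u p(1) unfolding exact_weights_def by blast
  finally have wu: "(\<Sum>j<N. (w j)\<^sup>2 / \<theta> j) = (\<Sum>j<N. u j * p (x j))" using nw by simp
  have "wip N \<theta> v (\<lambda>j. p (x j)) = wip N \<theta> (\<lambda>j. p (x j)) (\<lambda>j. p (x j))"
    using p(2)[OF p(1)] by (simp add: wip_def algebra_simps sum_subtractf)
  moreover have "wip N \<theta> v (\<lambda>j. p (x j)) = (\<Sum>j<N. w j * p (x j))"
    unfolding wip_def by (rule sum.cong) (use theta_pos in \<open>force simp: v_def\<close>)+
  moreover have "(\<Sum>j<N. w j * p (x j)) = Dop k c p z"
    using lsq_weights_exact[OF w] p(1) unfolding exact_weights_def by simp
  ultimately have pp: "wip N \<theta> (\<lambda>j. p (x j)) (\<lambda>j. p (x j)) = (\<Sum>j<N. (w j)\<^sup>2 / \<theta> j)"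
    using \<open>(\<Sum>j<N. w j * v j) = Dop k c p z\<close> nw by simp
  define W where "W = (\<Sum>j<N. (w j)\<^sup>2 / \<theta> j)"
  define U where "U = (\<Sum>j<N. (u j)\<^sup>2 / \<theta> j)"
  have W: "W \<ge> 0" and U: "U \<ge> 0"
    unfolding W_def U_def using theta_pos by (auto intro!: sum_nonneg divide_nonneg_pos)
  have "W\<^sup>2 = (\<Sum>j<N. (u j / sqrt (\<theta> j)) * (sqrt (\<theta> j) * p (x j)))\<^sup>2"
    unfolding W_def wu using theta_pos
    by (intro arg_cong[of _ _ "\<lambda>t. t\<^sup>2"] sum.cong) (force simp: less_imp_neq)+
  also have "\<dots> \<le> (\<Sum>j<N. (u j / sqrt (\<theta> j))\<^sup>2) * (\<Sum>j<N. (sqrt (\<theta> j) * p (x j))\<^sup>2)"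
    by (rule Cauchy_Schwarz_ineq_sum)
  also have "(\<Sum>j<N. (u j / sqrt (\<theta> j))\<^sup>2) = U"
    unfolding U_def by (rule sum.cong) (use theta_pos in \<open>auto simp: power_divide less_imp_le\<close>)
  also have "(\<Sum>j<N. (sqrt (\<theta> j) * p (x j))\<^sup>2) = W"
    unfolding W_def pp[symmetric] wip_def
    by (rule sum.cong) (use theta_pos in \<open>auto simp: power_mult_distrib power2_eq_square less_imp_le\<close>)
  finally have "W\<^sup>2 \<le> U * W" .
  then have "W \<le> U"
    using W U by (cases "W = 0") (auto simp: power2_eq_square)
  then show ?thesis unfolding W_def U_def by simp
qed

text \<open>\<open>w\<close> is itself exact, so the infimum is taken over a nonempty set of upper
  bounds for its norm.\<close>

lemma lsq_weights_le_rho: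
  assumes "\<And>v. Dop k c (lsq q N \<theta> x v) z = (\<Sum>j<N. w j * v j)"
  shows "sqrt (\<Sum>j<N. (w j)\<^sup>2 / \<theta> j) \<le> rho q k c z N x \<theta>"
  unfolding rho_def
proof (rule cInf_greatest)
  show "{sqrt (\<Sum>j<N. (w j)\<^sup>2 / \<theta> j) |w. exact_weights q k c z N x w} \<noteq> {}"
    using lsq_weights_exact[OF assms] by blast
qed (use lsq_weights_minimal[OF assms] in blast)

text \<open>The differential operator sees \<open>f\<close> only through its Taylor polynomial
  because \<open>k \<le> r\<close>, and that polynomial is reproduced because \<open>r < q\<close>.
  The remainder bound \<open>d j * C\<close> is left open so that one argument serves both
  seminorms.\<close>

lemma numdiff_error_bound:
  assumes w: "\<And>v. Dop k c (lsq q N \<theta> x v) z = (\<Sum>j<N. w j * v j)"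
    and r: "k \<le> r" "r < q"
    and R: "\<And>j. j < N \<Longrightarrow> \<bar>f (x j) - taylor_poly r f z (x j)\<bar> \<le> d j * C"
    and nonneg: "0 \<le> C" "\<And>j. 0 \<le> d j"
  shows "\<bar>Dop k c f z - (\<Sum>j<N. w j * f (x j))\<bar> \<le> rho q k c z N x \<theta> * sqrt (\<Sum>j<N. \<theta> j * (d j)\<^sup>2) * C"
proof -
  let ?T = "taylor_poly r f z"
  have "Dop k c f z = (\<Sum>j<N. w j * ?T (x j))"
    using lsq_weights_exact[OF w] taylor_poly_in_polys[OF r(2), of f z] Dop_taylor_poly[OF r(1), of c f z]
    unfolding exact_weights_def by simp
  then have "\<bar>Dop k c f z - (\<Sum>j<N. w j * f (x j))\<bar> = \<bar>\<Sum>j<N. w j * (f (x j) - ?T (x j))\<bar>"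
    by (simp add: right_diff_distrib sum_subtractf abs_minus_commute)
  also have "\<dots> \<le> (\<Sum>j<N. \<bar>w j\<bar> * (d j * C))"
    by (rule sum_abs[THEN order_trans], rule sum_mono) (auto simp: abs_mult intro!: mult_left_mono R)
  also have "\<dots> = (\<Sum>j<N. \<bar>w j / sqrt (\<theta> j)\<bar> * \<bar>sqrt (\<theta> j) * d j\<bar>) * C"
    unfolding sum_distrib_right
  proof (rule sum.cong)
    fix j assume "j \<in> {..<N}"
    then have "sqrt (\<theta> j) > 0" using theta_pos by simp
    then show "\<bar>w j\<bar> * (d j * C) = \<bar>w j / sqrt (\<theta> j)\<bar> * \<bar>sqrt (\<theta> j) * d j\<bar> * C"
      using nonneg(2)[of j] by (simp add: abs_mult)
  qed simp
  also have "\<dots> \<le> (L2_set (\<lambda>j. w j / sqrt (\<theta> j)) {..<N} * L2_set (\<lambda>j. sqrt (\<theta> j) * d j) {..<N}) * C"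
    by (intro mult_right_mono L2_set_mult_ineq nonneg)
  also have "L2_set (\<lambda>j. w j / sqrt (\<theta> j)) {..<N} = sqrt (\<Sum>j<N. (w j)\<^sup>2 / \<theta> j)"
    unfolding L2_set_def by (intro arg_cong[of _ _ sqrt] sum.cong) (use theta_pos in \<open>auto simp: power_divide less_imp_le\<close>)
  also have "L2_set (\<lambda>j. sqrt (\<theta> j) * d j) {..<N} = sqrt (\<Sum>j<N. \<theta> j * (d j)\<^sup>2)"
    unfolding L2_set_def by (intro arg_cong[of _ _ sqrt] sum.cong) (use theta_pos in \<open>auto simp: power_mult_distrib less_imp_le\<close>)
  also have "sqrt (\<Sum>j<N. (w j)\<^sup>2 / \<theta> j) * sqrt (\<Sum>j<N. \<theta> j * (d j)\<^sup>2) * C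
      \<le> rho q k c z N x \<theta> * sqrt (\<Sum>j<N. \<theta> j * (d j)\<^sup>2) * C"
    using theta_pos by (intro mult_right_mono lsq_weights_le_rho[OF w] nonneg real_sqrt_ge_zero sum_nonneg)
      (auto simp: less_imp_le)
  finally show ?thesis .
qed

end

subsection \<open>Mollification\<close>

definition flat_exp :: "nat \<Rightarrow> real \<Rightarrow> real" where
  "flat_exp k t = (if t > 0 then (1 / t) ^ k * exp (- 1 / t) else 0)"

lemma flat_exp_tendsto_0: "(flat_exp k \<longlongrightarrow> 0) (at_right 0)"
proof -
  have "((\<lambda>t. (inverse t) ^ k / exp (inverse t)) \<longlongrightarrow> (0::real)) (at_right 0)"
    by (rule filterlim_compose[OF tendsto_power_div_exp_0 filterlim_inverse_at_top_right])
  moreover have "\<forall>\<^sub>F t in at_right 0. (inverse t) ^ k / exp (inverse t) = flat_exp k t"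
    using eventually_at_right_less by (rule eventually_mono) (simp add: flat_exp_def exp_minus field_simps)
  ultimately show ?thesis by (rule Lim_transform_eventually)
qed

text \<open>The powers of \<open>1 / t\<close> in \<open>flat_exp\<close> are there to close the
  family under differentiation. At 0 the difference quotient of \<open>flat_exp k\<close> is exactly
  \<open>flat_exp (Suc k)\<close>, which tends to 0 from the right and is 0 on the left.\<close>

lemma flat_exp_derivative:
  "(flat_exp k has_real_derivative flat_exp (k + 2) t - real k * flat_exp (Suc k) t) (at t)"
proof -
  consider "t > 0" | "t < 0" | "t = 0" by linarith
  then show ?thesis
  proof cases
    case 1
    have "((\<lambda>t. (1 / t) ^ k * exp (- 1 / t)) has_real_derivative
        (1 / t) ^ (k + 2) * exp (- 1 / t) - real k * ((1 / t) ^ Suc k * exp (- 1 / t))) (at t)"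
    proof (cases k)
      case 0
      then show ?thesis using 1 by (auto intro!: derivative_eq_intros simp: power2_eq_square)
    next
      case (Suc l)
      show ?thesis unfolding Suc using 1
        by (auto intro!: derivative_eq_intros simp: power2_eq_square field_simps) (cases l, auto)
    qed
    then have "(flat_exp k has_real_derivative
        (1 / t) ^ (k + 2) * exp (- 1 / t) - real k * ((1 / t) ^ Suc k * exp (- 1 / t))) (at t)"
      by (rule has_field_derivative_transform_within_open[where S = "{0<..}"])
        (use 1 in \<open>auto simp: flat_exp_def\<close>)
    then show ?thesis using 1 by (simp add: flat_exp_def)
  next
    case 2
    have "((\<lambda>t. 0) has_real_derivative 0) (at t)" by simp
    then have "(flat_exp k has_real_derivative 0) (at t)"
      by (rule has_field_derivative_transform_within_open[where S = "{..<0}"])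
        (use 2 in \<open>auto simp: flat_exp_def\<close>)
    then show ?thesis using 2 by (simp add: flat_exp_def)
  next
    case 3
    have "(\<lambda>h. (flat_exp k (0 + h) - flat_exp k 0) / h) \<midarrow>0\<rightarrow> 0"
    proof -
      have eq: "(flat_exp k (0 + h) - flat_exp k 0) / h = flat_exp (Suc k) h" for h
        by (simp add: flat_exp_def)
      have "(flat_exp (Suc k) \<longlongrightarrow> 0) (at_left 0)"
      proof (rule tendsto_eventually)
        show "\<forall>\<^sub>F h in at_left 0. flat_exp (Suc k) h = 0"
          unfolding eventually_at_filter by (simp add: flat_exp_def)
      qed
      with flat_exp_tendsto_0 show ?thesis
        unfolding eq by (simp add: filterlim_split_at)
    qed
    then show ?thesis using 3 by (simp add: DERIV_def flat_exp_def)
  qed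
qed

text \<open>A linear span that is closed under differentiation and whose members all vanish outside
  (-1, 1): one factor dies for \<open>t \<le> -1\<close>, the other for \<open>t \<ge> 1\<close>. A
  full sequence of derivatives can be chosen inside it.\<close>

inductive_set bumps :: "(real \<Rightarrow> real) set" where
  base: "(\<lambda>t. flat_exp k (1 + t) * flat_exp l (1 - t)) \<in> bumps"
| add: "f \<in> bumps \<Longrightarrow> g \<in> bumps \<Longrightarrow> (\<lambda>t. f t + g t) \<in> bumps"
| cmult: "f \<in> bumps \<Longrightarrow> (\<lambda>t. a * f t) \<in> bumps"

lemma bumps_derivative: "f \<in> bumps \<Longrightarrow> \<exists>f'\<in>bumps. \<forall>t. (f has_real_derivative f' t) (at t)"
proof (induction rule: bumps.induct)
  case (base k l)
  let ?b = "\<lambda>k l t. flat_exp k (1 + t) * flat_exp l (1 - t)"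
  define f' where "f' t = ?b (k + 2) l t + ((- real k) * ?b (Suc k) l t + ((- 1) * ?b k (l + 2) t + real l * ?b k (Suc l) t))" for t
  have "f' \<in> bumps"
    unfolding f'_def[abs_def] by (intro bumps.intros)
  moreover have "(?b k l has_real_derivative f' t) (at t)" for t
  proof -
    have "((\<lambda>t. flat_exp k (1 + t)) has_real_derivative
        (flat_exp (k + 2) (1 + t) - real k * flat_exp (Suc k) (1 + t)) * 1) (at t)"
      by (rule DERIV_chain2[OF flat_exp_derivative]) (auto intro!: derivative_eq_intros)
    moreover have "((\<lambda>t. flat_exp l (1 - t)) has_real_derivative
        (flat_exp (l + 2) (1 - t) - real l * flat_exp (Suc l) (1 - t)) * (- 1)) (at t)"
      by (rule DERIV_chain2[OF flat_exp_derivative]) (auto intro!: derivative_eq_intros)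
    ultimately show ?thesis
      by (rule DERIV_cong[OF DERIV_mult]) (simp add: f'_def algebra_simps)
  qed
  ultimately show ?case by blast
next
  case (add f g)
  then obtain f' g' where "f' \<in> bumps" "g' \<in> bumps" "\<And>t. (f has_real_derivative f' t) (at t)"
    "\<And>t. (g has_real_derivative g' t) (at t)" by blast
  then show ?case by (intro bexI[of _ "\<lambda>t. f' t + g' t"]) (auto intro: bumps.add DERIV_add)
next
  case (cmult f a)
  then obtain f' where "f' \<in> bumps" "\<And>t. (f has_real_derivative f' t) (at t)" by blast
  then show ?case by (intro bexI[of _ "\<lambda>t. a * f' t"]) (auto intro: bumps.cmult DERIV_cmult)
qed

lemma bumps_vanish: "f \<in> bumps \<Longrightarrow> \<bar>t\<bar> \<ge> 1 \<Longrightarrow> f t = 0"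
  by (induction rule: bumps.induct) (auto simp: flat_exp_def)

lemma exists_bump:
  obtains \<psi> :: "nat \<Rightarrow> real \<Rightarrow> real" where
    "\<And>m t. (\<psi> m has_real_derivative \<psi> (Suc m) t) (at t)"
    "\<And>m t. \<bar>t\<bar> \<ge> 1 \<Longrightarrow> \<psi> m t = 0" "\<And>t. \<psi> 0 t \<ge> 0" "\<psi> 0 0 > 0"
proof -
  define \<psi>0 where "\<psi>0 t = flat_exp 0 (1 + t) * flat_exp 0 (1 - t)" for t
  \<comment> \<open>The conjunct for \<open>m = 0\<close> pins down the start of the dependent
    choice, so that sign and positivity at 0 remain known.\<close>
  have "\<exists>\<psi>. \<forall>m. (\<psi> m \<in> bumps \<and> (m = 0 \<longrightarrow> \<psi> m = \<psi>0)) \<and> (\<forall>t. (\<psi> m has_real_derivative \<psi> (Suc m) t) (at t))"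
  proof (rule dependent_nat_choice)
    show "\<exists>f. f \<in> bumps \<and> (0 = (0::nat) \<longrightarrow> f = \<psi>0)"
      using bumps.base[of 0 0] by (auto simp: \<psi>0_def[abs_def])
    show "\<exists>g. (g \<in> bumps \<and> (Suc m = 0 \<longrightarrow> g = \<psi>0)) \<and> (\<forall>t. (f has_real_derivative g t) (at t))"
      if "f \<in> bumps \<and> (m = 0 \<longrightarrow> f = \<psi>0)" for f m
      using bumps_derivative[of f] that by auto
  qed
  then obtain \<psi> where \<psi>: "\<And>m. \<psi> m \<in> bumps" "\<psi> 0 = \<psi>0"
    "\<And>m t. (\<psi> m has_real_derivative \<psi> (Suc m) t) (at t)" by blast
  show ?thesis
    by (rule that[of \<psi>, OF \<psi>(3)]) (auto simp: bumps_vanish[OF \<psi>(1)] \<psi>(2) \<psi>0_def flat_exp_def)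
qed

lemma lborel_integral_reflect:
  fixes g :: "'a::euclidean_space \<Rightarrow> real"
  assumes [measurable]: "g \<in> borel_measurable borel"
  shows "(LINT u|lborel. g (y - u)) = (LINT u|lborel. g u)" "integrable lborel g \<Longrightarrow> integrable lborel (\<lambda>u. g (y - u))"
proof -
  have eq: "(lborel :: 'a measure) = distr lborel borel (\<lambda>u. y - u)"
    using lborel_affine[of "-1" y] by (simp add: density_1)
  show "(LINT u|lborel. g (y - u)) = (LINT u|lborel. g u)"
    by (subst (2) eq) (simp add: integral_distr)
  show "integrable lborel (\<lambda>u. g (y - u))" if "integrable lborel g"
    using that by (subst (asm) eq) (simp add: integrable_distr_eq)
qed

lemma integrable_continuous_compact_support:
  fixes g :: "real^'n::finite \<Rightarrow> real"
  assumes cont: "continuous_on UNIV g" and supp: "\<And>v. norm v \<ge> e \<Longrightarrow> g v = 0"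
  shows "integrable lborel g"
proof -
  have "set_integrable lborel (cball 0 e) g"
    using cont unfolding set_integrable_def
    by (intro borel_integrable_compact) (auto intro: continuous_on_subset)
  moreover have "(\<lambda>v. indicat_real (cball 0 e) v *\<^sub>R g v) = g"
  proof
    fix v show "indicat_real (cball 0 e) v *\<^sub>R g v = g v"
      using supp[of v] by (cases "norm v \<le> e") auto
  qed
  ultimately show ?thesis unfolding set_integrable_def by simp
qed

lemma exists_mollifier:
  fixes \<epsilon> :: real
  assumes "\<epsilon> > 0"
  obtains \<Phi> :: "'n::finite list \<Rightarrow> real^'n \<Rightarrow> real" where
    "\<And>L i v. has_partial (\<Phi> L) i (\<Phi> (i # L) v) v" "\<And>L. continuous_on UNIV (\<Phi> L)"
    "\<And>L v. norm v \<ge> \<epsilon> \<Longrightarrow> \<Phi> L v = 0" "\<And>v. \<Phi> [] v \<ge> 0" "(LINT v|lborel. \<Phi> [] v) = 1"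
proof -
  obtain \<psi> :: "nat \<Rightarrow> real \<Rightarrow> real" where \<psi>: "\<And>m t. (\<psi> m has_real_derivative \<psi> (Suc m) t) (at t)"
    "\<And>m t. \<bar>t\<bar> \<ge> 1 \<Longrightarrow> \<psi> m t = 0" "\<And>t. \<psi> 0 t \<ge> 0" "\<psi> 0 0 > 0"
    using exists_bump by blast
  \<comment> \<open>If \<open>norm v \<ge> \<epsilon>\<close>, then the l1 norm is at least
    \<epsilon> too, so some coordinate has modulus at least \<open>1 / s\<close>, and its rescaled
    bump factor vanishes together with all its derivatives.\<close>
  define s where "s = real CARD('n) / \<epsilon>"
  have s: "s > 0" using assms by (simp add: s_def)
  define F :: "unit \<Rightarrow> 'n \<Rightarrow> nat \<Rightarrow> real \<Rightarrow> real" where "F a i m t = s ^ m * \<psi> m (s * t)" for a i m t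
  have F: "(F a i m has_real_derivative F a i (Suc m) t) (at t)" for a i m t
  proof -
    have "((\<lambda>t. \<psi> m (s * t)) has_real_derivative \<psi> (Suc m) (s * t) * s) (at t)"
      by (rule DERIV_chain2[OF \<psi>(1)]) (auto intro!: derivative_eq_intros)
    from DERIV_cmult[OF this, of "s ^ m"] show ?thesis unfolding F_def by (simp add: mult_ac)
  qed
  define \<Psi> where "\<Psi> b = sum_prod {()} (\<lambda>_. b) F" for b
  have \<Psi>_eq: "\<Psi> b L v = b * (\<Prod>i\<in>UNIV. F () i (count_list L i) (v $ i))" for b L v
    by (simp add: \<Psi>_def sum_prod_def)
  have part: "has_partial (\<Psi> b L) i (\<Psi> b (i # L) v) v" for b L i v
    unfolding \<Psi>_def by (rule sum_prod_partial) (rule F)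
  have cont: "continuous_on UNIV (\<Psi> b L)" for b L
    unfolding \<Psi>_def by (rule sum_prod_continuous) (rule F)
  have supp: "\<Psi> b L v = 0" if "norm v \<ge> \<epsilon>" for b L v
  proof -
    have "\<exists>i. \<bar>s * v $ i\<bar> \<ge> 1"
    proof (rule ccontr)
      assume "\<not> ?thesis"
      then have "\<bar>v $ i\<bar> < 1 / s" for i
        using s by (simp add: abs_mult not_le pos_less_divide_eq mult.commute)
      then have "(\<Sum>i\<in>UNIV. \<bar>v $ i\<bar>) < (\<Sum>i\<in>(UNIV::'n set). 1 / s)"
        by (intro sum_strict_mono) auto
      also have "\<dots> = \<epsilon>" using s by (simp add: s_def)
      finally show False using norm_le_l1_cart[of v] that by simp
    qed
    then obtain i where "\<bar>s * v $ i\<bar> \<ge> 1" by blast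
    then have "F () i (count_list L i) (v $ i) = 0" by (simp add: F_def \<psi>(2))
    then have "(\<Prod>i\<in>UNIV. F () i (count_list L i) (v $ i)) = 0" by (intro prod_zero) auto
    then show ?thesis by (simp add: \<Psi>_eq)
  qed
  have nonneg: "\<Psi> b [] v \<ge> 0" if "b \<ge> 0" for b v
    using that \<psi>(3) by (simp add: \<Psi>_eq F_def prod_nonneg)
  have int: "integrable lborel (\<Psi> b L)" for b L
    using cont supp by (rule integrable_continuous_compact_support)
  define I where "I = (LINT v|lborel. \<Psi> 1 [] v)"
  \<comment> \<open>A nonnegative function of integral 0 vanishes off a null set; here the set where
    it is nonzero is open, hence would be empty, yet it contains 0.\<close>
  have "I \<noteq> 0"
  proof
    assume "I = 0"
    then have "AE v in lborel. \<Psi> 1 [] v = 0"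
      using integral_nonneg_eq_0_iff_AE[OF int, of 1 "[]"] nonneg by (simp add: I_def)
    moreover have op: "open {v. \<Psi> 1 [] v \<noteq> 0}"
      using cont[of 1 "[]"] open_Collect_neq[of "\<Psi> 1 []" "\<lambda>_. 0"] by simp
    ultimately have "{v. \<Psi> 1 [] v \<noteq> 0} \<in> null_sets lborel"
      by (subst (asm) AE_iff_null) auto
    then have "negligible {v. \<Psi> 1 [] v \<noteq> 0}"
      unfolding negligible_iff_null_sets by (rule null_sets_completionI)
    then have "{v. \<Psi> 1 [] v \<noteq> 0} = {}" using open_not_negligible[OF op] by blast
    moreover have "\<Psi> 1 [] 0 \<noteq> 0" using \<psi>(4) by (simp add: \<Psi>_eq F_def)
    ultimately show False by blast
  qed
  moreover have "I \<ge> 0" unfolding I_def using nonneg by simp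
  ultimately have I: "I > 0" by simp
  show ?thesis
  proof (rule that[of "\<Psi> (1 / I)"])
    have "\<Psi> (1 / I) [] v = (1 / I) * \<Psi> 1 [] v" for v by (simp add: \<Psi>_eq)
    then show "(LINT v|lborel. \<Psi> (1 / I) [] v) = 1" using I by (simp add: I_def)
  qed (use part cont supp nonneg I in auto)
qed

section \<open>Convolution with a smooth kernel\<close>

lemma has_partialI_quadratic:
  assumes "d > 0" "\<And>t. \<bar>t\<bar> < d \<Longrightarrow> \<bar>g (x + t *\<^sub>R axis i 1) - g x - t * D\<bar> \<le> M * t\<^sup>2"
  shows "has_partial g i D x"
proof -
  let ?q = "\<lambda>t. (g (x + t *\<^sub>R axis i 1) - g x) / t - D"
  have "\<forall>\<^sub>F t in at 0. norm (?q t) \<le> M * \<bar>t\<bar>"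
    unfolding eventually_at
  proof (intro exI[of _ d] conjI assms ballI impI)
    fix t :: real assume t: "t \<noteq> 0 \<and> dist t 0 < d"
    then have "?q t = (g (x + t *\<^sub>R axis i 1) - g x - t * D) / t"
      by (simp add: field_simps)
    then have "norm (?q t) = \<bar>g (x + t *\<^sub>R axis i 1) - g x - t * D\<bar> / \<bar>t\<bar>"
      by (simp add: abs_divide)
    also have "\<dots> \<le> M * t\<^sup>2 / \<bar>t\<bar>"
      using t assms(2)[of t] by (intro divide_right_mono) auto
    also have "\<dots> = M * \<bar>t\<bar>" using t by (simp add: power2_eq_square abs_if)
    finally show "norm (?q t) \<le> M * \<bar>t\<bar>" .
  qed
  moreover have "((\<lambda>t. M * \<bar>t\<bar>) \<longlongrightarrow> 0) (at 0)"
    by (auto intro!: tendsto_eq_intros)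
  ultimately have "(?q \<longlongrightarrow> 0) (at 0)" by (rule Lim_null_comparison)
  then have "((\<lambda>t. (g (x + t *\<^sub>R axis i 1) - g x) / t) \<longlongrightarrow> D) (at 0)"
    by (simp add: LIM_zero_iff)
  then show ?thesis by (simp add: has_partial_def DERIV_def)
qed

text \<open>The rough integrable factor \<open>F\<close> is kept in place and the kernel
  \<open>g\<close> is translated, so that all derivatives fall on \<open>g\<close>.\<close>

definition conv :: "(real^'n::finite \<Rightarrow> real) \<Rightarrow> (real^'n \<Rightarrow> real) \<Rightarrow> real^'n \<Rightarrow> real" where
  "conv F g y = (LINT u|lborel. F u * g (y - u))"

lemma continuous_translate_measurable:
  fixes g :: "real^'n::finite \<Rightarrow> real"
  assumes "continuous_on UNIV g"
  shows "(\<lambda>u. g (y - u)) \<in> borel_measurable borel"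
  by (rule borel_measurable_continuous_onI) (auto intro!: continuous_on_compose2[OF assms] continuous_intros)

lemma conv_integrable:
  fixes g :: "real^'n::finite \<Rightarrow> real"
  assumes "integrable lborel F" "continuous_on UNIV g" "\<And>v. \<bar>g v\<bar> \<le> B"
  shows "integrable lborel (\<lambda>u. F u * g (y - u))"
proof (rule Bochner_Integration.integrable_bound)
  show "integrable lborel (\<lambda>u. B * F u)" using assms(1) by simp
  have [measurable]: "F \<in> borel_measurable borel" using assms(1) by (simp add: integrable_iff_bounded)
  show "(\<lambda>u. F u * g (y - u)) \<in> borel_measurable lborel"
    using continuous_translate_measurable[OF assms(2)] by simp
  have "\<bar>F u * g (y - u)\<bar> \<le> \<bar>B * F u\<bar>" for u
    using assms(3)[of "y - u"] by (auto simp: abs_mult mult.commute[of B] intro!: mult_left_mono)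
  then show "AE u in lborel. norm (F u * g (y - u)) \<le> norm (B * F u)" by simp
qed

lemma conv_continuous:
  fixes g :: "real^'n::finite \<Rightarrow> real"
  assumes F: "integrable lborel F" and g: "continuous_on UNIV g" and B: "\<And>v. \<bar>g v\<bar> \<le> B"
  shows "continuous_on UNIV (conv F g)"
  unfolding continuous_on_sequentially comp_def
proof (intro allI ballI impI)
  fix s :: "nat \<Rightarrow> real^'n" and y assume "(\<forall>n. s n \<in> UNIV) \<and> s \<longlonglongrightarrow> y"
  then have s: "s \<longlonglongrightarrow> y" by simp
  show "(\<lambda>n. conv F g (s n)) \<longlonglongrightarrow> conv F g y"
    unfolding conv_def
  proof (rule integral_dominated_convergence[where w = "\<lambda>u. \<bar>B * F u\<bar>"])
    show "(\<lambda>u. F u * g (y - u)) \<in> borel_measurable lborel" "\<And>n. (\<lambda>u. F u * g (s n - u)) \<in> borel_measurable lborel"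
      using conv_integrable[OF F g B] by blast+
    show "integrable lborel (\<lambda>u. \<bar>B * F u\<bar>)" using F by simp
    have "(\<lambda>n. g (s n - u)) \<longlonglongrightarrow> g (y - u)" for u
      using g s by (intro continuous_on_tendsto_compose[OF g]) (auto intro!: tendsto_intros)
    then show "AE u in lborel. (\<lambda>n. F u * g (s n - u)) \<longlonglongrightarrow> F u * g (y - u)"
      by (intro AE_I2 tendsto_intros) auto
    have "\<bar>F u * g (s n - u)\<bar> \<le> \<bar>B * F u\<bar>" for u n
      using B[of "s n - u"] by (auto simp: abs_mult mult.commute[of B] intro!: mult_left_mono)
    then show "\<And>n. AE u in lborel. norm (F u * g (s n - u)) \<le> \<bar>B * F u\<bar>" by simp
  qed
qed

text \<open>The bound on \<open>g2\<close> makes the first order remainder of the kernel at most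
  \<open>B2 * t\<^sup>2\<close>, uniformly in \<open>u\<close>. Integrated against the modulus of
  \<open>F\<close> it stays quadratic in \<open>t\<close>, which proves differentiability.\<close>

lemma conv_partial:
  fixes g :: "real^'n::finite \<Rightarrow> real"
  assumes F: "integrable lborel F"
    and cont: "continuous_on UNIV g" "continuous_on UNIV g1"
    and bdd: "\<And>v. \<bar>g v\<bar> \<le> B" "\<And>v. \<bar>g1 v\<bar> \<le> B1" "\<And>v. \<bar>g2 v\<bar> \<le> B2"
    and part: "\<And>v. has_partial g i (g1 v) v" "\<And>v. has_partial g1 i (g2 v) v"
  shows "has_partial (conv F g) i (conv F g1 y) y"
proof (rule has_partialI_quadratic[OF zero_less_one])
  fix t :: real
  note int = conv_integrable[OF F cont(1) bdd(1)] conv_integrable[OF F cont(2) bdd(2)]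
  let ?R = "\<lambda>u. F u * g (y + t *\<^sub>R axis i 1 - u) - F u * g (y - u) - t * (F u * g1 (y - u))"
  have "conv F g (y + t *\<^sub>R axis i 1) - conv F g y - t * conv F g1 y = (LINT u|lborel. ?R u)"
    unfolding conv_def using int by simp
  also have "\<bar>\<dots>\<bar> \<le> (LINT u|lborel. B2 * t\<^sup>2 * \<bar>F u\<bar>)"
  proof (rule integral_abs_bound[THEN order_trans], rule integral_mono)
    show "integrable lborel (\<lambda>u. \<bar>?R u\<bar>)" using int by simp
    show "integrable lborel (\<lambda>u. B2 * t\<^sup>2 * \<bar>F u\<bar>)" using F by simp
    fix u
    have "?R u = F u * (g ((y - u) + t *\<^sub>R axis i 1) - g (y - u) - t * g1 (y - u))"
      by (simp add: algebra_simps)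
    moreover have "\<bar>g ((y - u) + t *\<^sub>R axis i 1) - g (y - u) - t * g1 (y - u)\<bar> \<le> B2 * t\<^sup>2"
      by (rule partial_second_order_bound[where E = g2]) (use part bdd in auto)
    ultimately show "\<bar>?R u\<bar> \<le> B2 * t\<^sup>2 * \<bar>F u\<bar>"
      by (simp add: abs_mult mult.commute mult_left_mono)
  qed
  finally show "\<bar>conv F g (y + t *\<^sub>R axis i 1) - conv F g y - t * conv F g1 y\<bar> \<le> B2 * (LINT u|lborel. \<bar>F u\<bar>) * t\<^sup>2"
    by (simp add: mult_ac)
qed

text \<open>Cutting \<open>f\<close> off to the bounded set
  \<open>\<Omega> \<inter> ball 0 R\<close> makes it integrable, and the cut-off is invisible at any
  \<open>y\<close> whose closed \<epsilon>-ball lies in that set. There the reflected kernel is a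
  test function, so derivatives of \<open>g\<close> become averages of the weak derivative, with
  nonnegative weights of total mass one; this is why \<open>C\<close> is not enlarged.\<close>

lemma exists_mollification:
  fixes f :: "real^'n::finite \<Rightarrow> real"
  assumes op: "open \<Omega>" and Linf: "Linf \<Omega> f" and eps: "\<epsilon> > 0"
  obtains g where "\<And>m. Cr m UNIV g"
    "\<And>\<alpha> h C y. weak_deriv \<Omega> \<alpha> f h \<Longrightarrow> AE u in lborel. u \<in> \<Omega> \<longrightarrow> \<bar>h u\<bar> \<le> C \<Longrightarrow> 0 \<le> C \<Longrightarrow>
        cball y \<epsilon> \<subseteq> \<Omega> \<inter> ball 0 R \<Longrightarrow> \<bar>mdiff \<alpha> g y\<bar> \<le> C"
    "\<And>y \<eta>. cball y \<epsilon> \<subseteq> \<Omega> \<inter> ball 0 R \<Longrightarrow> (\<And>u. u \<in> cball y \<epsilon> \<Longrightarrow> \<bar>f u - f y\<bar> \<le> \<eta>) \<Longrightarrow> \<bar>g y - f y\<bar> \<le> \<eta>"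
proof -
  obtain \<Phi> :: "'n list \<Rightarrow> real^'n \<Rightarrow> real" where part: "\<And>L i v. has_partial (\<Phi> L) i (\<Phi> (i # L) v) v"
    and cont: "\<And>L. continuous_on UNIV (\<Phi> L)" and supp: "\<And>L v. norm v \<ge> \<epsilon> \<Longrightarrow> \<Phi> L v = 0"
    and nonneg: "\<And>v. \<Phi> [] v \<ge> 0" and int1: "(LINT v|lborel. \<Phi> [] v) = 1"
    using exists_mollifier[OF eps] by blast
  have "\<exists>B. \<forall>v. \<bar>\<Phi> L v\<bar> \<le> B" for L
  proof -
    have "bounded (\<Phi> L ` cball 0 \<epsilon>)"
      using cont[of L] by (intro compact_imp_bounded compact_continuous_image) (auto intro: continuous_on_subset)
    then obtain B where "\<And>v. v \<in> cball 0 \<epsilon> \<Longrightarrow> \<bar>\<Phi> L v\<bar> \<le> B"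
      unfolding bounded_iff by force
    then have "\<bar>\<Phi> L v\<bar> \<le> max B 0" for v using supp[of v L] by (cases "norm v \<le> \<epsilon>") (auto simp: le_max_iff_disj)
    then show ?thesis by blast
  qed
  then obtain B where B: "\<And>L v. \<bar>\<Phi> L v\<bar> \<le> B L" by metis
  have \<Phi>m: "\<Phi> [] \<in> borel_measurable borel" using cont borel_measurable_continuous_onI by blast
  have int\<Phi>: "integrable lborel (\<Phi> [])"
    using int1 not_integrable_integral_eq by force
  have int_refl: "integrable lborel (\<lambda>u. \<Phi> [] (y - u))" "(LINT u|lborel. \<Phi> [] (y - u)) = 1" for y
    using lborel_integral_reflect[OF \<Phi>m] int\<Phi> int1 by auto
  define A where "A = \<Omega> \<inter> ball 0 R"
  define F where "F u = indicat_real A u * f u" for u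
  have F: "integrable lborel F"
  proof -
    obtain C where C: "AE u in lborel. u \<in> \<Omega> \<longrightarrow> \<bar>f u\<bar> \<le> C" using Linf by (auto simp: Linf_def)
    have "(\<lambda>u. indicat_real \<Omega> u * f u) \<in> borel_measurable lborel"
      using Linf by (simp add: Linf_def set_borel_measurable_def)
    then have "integrable lborel (\<lambda>u. indicat_real (\<Omega> \<inter> ball 0 R) u *\<^sub>R (indicat_real \<Omega> u * f u))"
    proof (rule integrableI_bounded_set_indicator[rotated])
      show "\<Omega> \<inter> ball 0 R \<in> sets lborel" using op by simp
      have "emeasure lborel (\<Omega> \<inter> ball 0 R) \<le> emeasure lborel (ball (0::real^'n) R)"
        by (rule emeasure_mono) auto
      also have "\<dots> < \<infinity>" using emeasure_lborel_ball_finite by simp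
      finally show "emeasure lborel (\<Omega> \<inter> ball 0 R) < \<infinity>" .
      show "AE u in lborel. u \<in> \<Omega> \<inter> ball 0 R \<longrightarrow> norm (indicat_real \<Omega> u * f u) \<le> C"
        using C by eventually_elim auto
    qed
    moreover have "(\<lambda>u. indicat_real (\<Omega> \<inter> ball 0 R) u *\<^sub>R (indicat_real \<Omega> u * f u)) = F"
      by (auto simp: F_def A_def indicator_def)
    ultimately show ?thesis by simp
  qed
  define g where "g = conv F (\<Phi> [])"
  have parts: "has_partial (conv F (\<Phi> L)) i (conv F (\<Phi> (i # L)) y) y" for L i y
    by (rule conv_partial[where ?g2.0 = "\<Phi> (i # i # L)"]) (use F cont B part in auto)
  have pdl_g: "pdl L g = conv F (\<Phi> L)" for L
    by (rule pdl_eq_family[where P = "\<lambda>L. conv F (\<Phi> L)"]) (use parts in \<open>auto simp: g_def\<close>)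
  have Cr_g: "Cr m UNIV g" for m
    by (rule Cr_family[where P = "\<lambda>L. conv F (\<Phi> L)"])
      (use parts conv_continuous[OF F cont B] in \<open>auto simp: g_def\<close>)
  have outside: "\<Phi> L (y - u) = 0" if "cball y \<epsilon> \<subseteq> A" "u \<notin> A" for L y u
  proof -
    have "\<not> dist y u \<le> \<epsilon>" using that by (auto simp: subset_iff)
    then show ?thesis by (intro supp) (simp add: dist_norm)
  qed
  show ?thesis
  proof (rule that[of g, OF Cr_g])
    fix \<alpha> h C y
    assume h: "weak_deriv \<Omega> \<alpha> f h" and C: "AE u in lborel. u \<in> \<Omega> \<longrightarrow> \<bar>h u\<bar> \<le> C" "0 \<le> C"
      and y: "cball y \<epsilon> \<subseteq> \<Omega> \<inter> ball 0 R"
    define \<phi> where "\<phi> u = \<Phi> [] (y - u)" for u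
    \<comment> \<open>Differentiating the reflected kernel gives one sign per letter. These signs
      cancel against the power of -1 in the definition of the weak derivative.\<close>
    define P where "P L u = (-1) ^ length L * \<Phi> L (y - u)" for L u
    have P_part: "has_partial (P L) i (P (i # L) u) u" for L i u
    proof -
      have "((\<lambda>t. \<Phi> L ((y - u) + (- t) *\<^sub>R axis i 1)) has_real_derivative \<Phi> (i # L) (y - u) * (- 1)) (at 0)"
        by (rule DERIV_chain2[where f = "\<lambda>t. \<Phi> L ((y - u) + t *\<^sub>R axis i 1)"])
          (use part[of L i "y - u"] in \<open>auto simp: has_partial_def intro!: derivative_eq_intros\<close>)
      from DERIV_cmult[OF this, of "(-1) ^ length L"] show ?thesis
        by (simp add: has_partial_def P_def algebra_simps)
    qed
    have P_cont: "continuous_on UNIV (P L)" for L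
      unfolding P_def by (intro continuous_intros continuous_on_compose2[OF cont]) auto
    have P_Nil: "P [] = \<phi>" by (simp add: fun_eq_iff P_def \<phi>_def)
    have pdl_\<phi>: "pdl L \<phi> = P L" for L
      by (rule pdl_eq_family[of P \<phi>, OF P_Nil P_part])
    have "{u. \<phi> u \<noteq> 0} \<subseteq> cball y \<epsilon>"
    proof
      fix u assume "u \<in> {u. \<phi> u \<noteq> 0}"
      then have "\<not> norm (y - u) \<ge> \<epsilon>" using supp[of "y - u" "[]"] by (auto simp: \<phi>_def)
      then show "u \<in> cball y \<epsilon>" by (simp add: dist_norm)
    qed
    then have cl: "closure {u. \<phi> u \<noteq> 0} \<subseteq> cball y \<epsilon>" by (rule closure_minimal) simp
    have "test_fun \<Omega> \<phi>"
      unfolding test_fun_def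
    proof (intro conjI allI)
      show "Cr r UNIV \<phi>" for r
        by (rule Cr_family[of P \<phi>, OF P_Nil P_part P_cont])
      show "compact (closure {u. \<phi> u \<noteq> 0})"
        using cl by (meson bounded_cball bounded_subset closed_closure compact_eq_bounded_closed)
      show "closure {u. \<phi> u \<noteq> 0} \<subseteq> \<Omega>" using cl y by auto
    qed
    then have weak: "(LINT u:\<Omega>|lborel. f u * mdiff \<alpha> \<phi> u) = (-1) ^ mabs \<alpha> * (LINT u:\<Omega>|lborel. h u * \<phi> u)"
      and hint: "set_integrable lborel \<Omega> (\<lambda>u. h u * \<phi> u)"
      using h unfolding weak_deriv_def by blast+
    have "mdiff \<alpha> \<phi> u = (-1) ^ mabs \<alpha> * \<Phi> (mlist \<alpha>) (y - u)" for u
      by (simp add: mdiff_mlist pdl_\<phi> P_def)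
    then have "(LINT u:\<Omega>|lborel. f u * mdiff \<alpha> \<phi> u)
        = (LINT u|lborel. (-1) ^ mabs \<alpha> * (F u * \<Phi> (mlist \<alpha>) (y - u)))"
      unfolding set_lebesgue_integral_def using outside[of y _ "mlist \<alpha>"] y
      by (intro Bochner_Integration.integral_cong) (auto simp: F_def A_def indicator_def)
    then have "(-1) ^ mabs \<alpha> * conv F (\<Phi> (mlist \<alpha>)) y = (-1) ^ mabs \<alpha> * (LINT u:\<Omega>|lborel. h u * \<phi> u)"
      using weak by (simp add: conv_def)
    then have "mdiff \<alpha> g y = (LINT u:\<Omega>|lborel. h u * \<phi> u)"
      by (simp add: mdiff_mlist pdl_g)
    also have "\<bar>\<dots>\<bar> \<le> (LINT u|lborel. C * \<phi> u)"
      unfolding set_lebesgue_integral_def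
    proof (rule integral_abs_bound[THEN order_trans], rule integral_mono_AE)
      show "integrable lborel (\<lambda>u. \<bar>indicat_real \<Omega> u *\<^sub>R (h u * \<phi> u)\<bar>)"
        using hint by (auto simp: set_integrable_def)
      show "integrable lborel (\<lambda>u. C * \<phi> u)" using int_refl(1) by (simp add: \<phi>_def)
      show "AE u in lborel. \<bar>indicat_real \<Omega> u *\<^sub>R (h u * \<phi> u)\<bar> \<le> C * \<phi> u"
        using C(1)
      proof eventually_elim
        case (elim u)
        then show ?case using nonneg[of "y - u"] C(2)
          by (auto simp: indicator_def abs_mult \<phi>_def intro!: mult_right_mono)
      qed
    qed
    also have "\<dots> = C" using int_refl(2) by (simp add: \<phi>_def)
    finally show "\<bar>mdiff \<alpha> g y\<bar> \<le> C" .
  next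
    fix y \<eta>
    assume y: "cball y \<epsilon> \<subseteq> \<Omega> \<inter> ball 0 R" and \<eta>: "\<And>u. u \<in> cball y \<epsilon> \<Longrightarrow> \<bar>f u - f y\<bar> \<le> \<eta>"
    have int: "integrable lborel (\<lambda>u. F u * \<Phi> [] (y - u))"
      by (rule conv_integrable[OF F cont B])
    have "g y - f y = (LINT u|lborel. F u * \<Phi> [] (y - u)) - (LINT u|lborel. f y * \<Phi> [] (y - u))"
      using int_refl(2) by (simp add: g_def conv_def)
    also have "\<dots> = (LINT u|lborel. F u * \<Phi> [] (y - u) - f y * \<Phi> [] (y - u))"
      using int int_refl(1) by simp
    also have "\<bar>\<dots>\<bar> \<le> (LINT u|lborel. \<eta> * \<Phi> [] (y - u))"
    proof (rule integral_abs_bound[THEN order_trans], rule integral_mono)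
      show "integrable lborel (\<lambda>u. \<bar>F u * \<Phi> [] (y - u) - f y * \<Phi> [] (y - u)\<bar>)"
        using int int_refl(1) by simp
      show "integrable lborel (\<lambda>u. \<eta> * \<Phi> [] (y - u))" using int_refl(1) by simp
      fix u
      show "\<bar>F u * \<Phi> [] (y - u) - f y * \<Phi> [] (y - u)\<bar> \<le> \<eta> * \<Phi> [] (y - u)"
      proof (cases "u \<in> cball y \<epsilon>")
        case True
        then have "u \<in> A" using y unfolding A_def by blast
        then have "F u = f u" by (simp add: F_def)
        then show ?thesis using \<eta>[OF True] nonneg[of "y - u"]
          by (simp add: abs_mult mult_right_mono flip: left_diff_distrib)
      next
        case False
        then have "\<Phi> [] (y - u) = 0" by (intro supp) (simp add: dist_norm)
        then show ?thesis by simp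
      qed
    qed
    also have "\<dots> = \<eta>" using int_refl(2) by simp
    finally show "\<bar>g y - f y\<bar> \<le> \<eta>" .
  qed
qed

subsection \<open>Passing to the limit\<close>

text \<open>The difference quotient of \<open>u n\<close> with step \<open>t\<close> is within
  \<open>M * \<bar>t\<bar>\<close> of \<open>v n\<close>, uniformly in \<open>n\<close>. Fixing a
  small \<open>t\<close> and then taking \<open>n\<close> large shows that \<open>v\<close> is
  uniformly Cauchy; the same inequality, passed to the limit, identifies the limit of
  \<open>v\<close> as the partial derivative of \<open>U\<close>.\<close>

lemma uniform_limit_partial:
  fixes u v w :: "nat \<Rightarrow> real^'n::finite \<Rightarrow> real"
  assumes u: "\<And>n y. y \<in> ball z \<delta> \<Longrightarrow> has_partial (u n) i (v n y) y"
    and v: "\<And>n y. y \<in> ball z \<delta> \<Longrightarrow> has_partial (v n) i (w n y) y"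
    and w: "\<And>n y. y \<in> ball z \<delta> \<Longrightarrow> \<bar>w n y\<bar> \<le> M"
    and lim: "\<And>\<rho>. \<rho> < \<delta> \<Longrightarrow> uniform_limit (ball z \<rho>) u U sequentially"
    and \<rho>: "\<rho> < \<delta>"
  shows "uniform_limit (ball z \<rho>) v (pdiff i U) sequentially"
proof (cases "\<rho> > 0")
  case False
  then have empty: "ball z \<rho> = {}" by simp
  show ?thesis unfolding uniform_limit_iff empty by simp
next
  case True
  have M: "M \<ge> 0" using w[of z 0] True \<rho> by force
  \<comment> \<open>An intermediate radius: points shifted by at most \<tau> from
    \<open>ball z \<rho>\<close> stay in \<open>ball z \<rho>'\<close>, where \<open>u\<close> still
    converges uniformly.\<close>
  define \<rho>' where "\<rho>' = (\<rho> + \<delta>) / 2"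
  define \<tau> where "\<tau> = \<rho>' - \<rho>"
  have \<rho>': "\<rho> < \<rho>'" "\<rho>' < \<delta>" and \<tau>: "\<tau> > 0" using \<rho> by (auto simp: \<rho>'_def \<tau>_def field_simps)
  have near: "y + s *\<^sub>R axis i 1 \<in> ball z \<rho>'" if "y \<in> ball z \<rho>" "\<bar>s\<bar> \<le> \<tau>" for y s
  proof -
    have "dist z (y + s *\<^sub>R axis i 1) \<le> dist z y + dist y (y + s *\<^sub>R axis i 1)" by (rule dist_triangle)
    also have "dist y (y + s *\<^sub>R axis i 1) = \<bar>s\<bar>" by (simp add: dist_norm norm_axis_1)
    finally show ?thesis using that by (simp add: \<tau>_def)
  qed
  have taylor: "\<bar>u n (y + t *\<^sub>R axis i 1) - u n y - t * v n y\<bar> \<le> M * t\<^sup>2" if y: "y \<in> ball z \<rho>" and t: "\<bar>t\<bar> \<le> \<tau>" for n y t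
  proof (rule partial_second_order_bound[where E = "w n"])
    fix s assume "\<bar>s\<bar> \<le> \<bar>t\<bar>"
    then have "y + s *\<^sub>R axis i 1 \<in> ball z \<delta>" using near[OF y, of s] t \<rho>' by auto
    then show "has_partial (u n) i (v n (y + s *\<^sub>R axis i 1)) (y + s *\<^sub>R axis i 1)"
      "has_partial (v n) i (w n (y + s *\<^sub>R axis i 1)) (y + s *\<^sub>R axis i 1)"
      "\<bar>w n (y + s *\<^sub>R axis i 1)\<bar> \<le> M" using u v w by auto
  qed
  have "uniformly_Cauchy_on (ball z \<rho>) v"
    unfolding uniformly_Cauchy_on_def
  proof (intro allI impI)
    fix e :: real assume e: "e > 0"
    \<comment> \<open>Then \<open>M * t \<le> e / 4\<close>. The two Taylor defects and the four
      values of \<open>u\<close> contribute at most \<open>e / 2\<close> and \<open>e / 4\<close>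
      after division by \<open>t\<close>. Using \<open>M + 1\<close> avoids dividing by 0.\<close>
    define t where "t = min \<tau> (e / (4 * (M + 1)))"
    have t: "0 < t" "t \<le> \<tau>" using \<tau> e M by (auto simp: t_def)
    have Mt: "M * t \<le> e / 4"
    proof -
      have "M * t \<le> (M + 1) * (e / (4 * (M + 1)))"
        using M t by (intro mult_mono) (auto simp: t_def)
      also have "\<dots> = e / 4" using M by (simp add: field_simps)
      finally show ?thesis .
    qed
    have "\<forall>\<^sub>F n in sequentially. \<forall>y\<in>ball z \<rho>'. dist (u n y) (U y) < e * t / 16"
      using uniform_limitD[OF lim[OF \<rho>'(2)], of "e * t / 16"] e t by simp
    then obtain n0 where n0: "\<And>n y. n \<ge> n0 \<Longrightarrow> y \<in> ball z \<rho>' \<Longrightarrow> \<bar>u n y - U y\<bar> < e * t / 16"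
      unfolding eventually_sequentially dist_real_def by blast
    have "dist (v m y) (v n y) < e" if y: "y \<in> ball z \<rho>" and mn: "m \<ge> n0" "n \<ge> n0" for m n y
    proof -
      have y': "y \<in> ball z \<rho>'" "y + t *\<^sub>R axis i 1 \<in> ball z \<rho>'" using near[OF y, of t] y \<rho>' t by auto
      have "\<bar>t * v m y - t * v n y\<bar> \<le> 2 * (M * t\<^sup>2) + 4 * (e * t / 16)"
        using taylor[OF y, of t m] taylor[OF y, of t n] t n0[OF mn(1) y'(1)] n0[OF mn(1) y'(2)]
          n0[OF mn(2) y'(1)] n0[OF mn(2) y'(2)] by linarith
      also have "\<dots> = t * (2 * (M * t) + e / 4)" by (simp add: power2_eq_square algebra_simps)
      also have "\<dots> < t * e" using t e Mt by (intro mult_strict_left_mono) auto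
      finally have "t * \<bar>v m y - v n y\<bar> < t * e"
        using t by (simp add: abs_mult flip: right_diff_distrib)
      then show ?thesis using t by (simp add: dist_real_def)
    qed
    then show "\<exists>n0. \<forall>y\<in>ball z \<rho>. \<forall>m\<ge>n0. \<forall>n\<ge>n0. dist (v m y) (v n y) < e" by blast
  qed
  then obtain V where V: "uniform_limit (ball z \<rho>) v V sequentially"
    using Cauchy_uniformly_convergent unfolding uniformly_convergent_on_def by blast
  have "pdiff i U y = V y" if y: "y \<in> ball z \<rho>" for y
  proof (rule has_partial_pdiff, rule has_partialI_quadratic[OF \<tau>])
    fix t assume t: "\<bar>t\<bar> < \<tau>"
    have "(\<lambda>n. u n y') \<longlonglongrightarrow> U y'" if "y' \<in> ball z \<rho>'" for y'
      using tendsto_uniform_limitI[OF lim[OF \<rho>'(2)] that] .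
    then have "(\<lambda>n. \<bar>u n (y + t *\<^sub>R axis i 1) - u n y - t * v n y\<bar>) \<longlonglongrightarrow> \<bar>U (y + t *\<^sub>R axis i 1) - U y - t * V y\<bar>"
      using near[OF y, of t] near[OF y, of 0] t \<tau> tendsto_uniform_limitI[OF V y] by (intro tendsto_intros) auto
    then show "\<bar>U (y + t *\<^sub>R axis i 1) - U y - t * V y\<bar> \<le> M * t\<^sup>2"
      using taylor[OF y, of t] t by (intro LIMSEQ_le_const2) auto
  qed
  then show ?thesis
    using V uniform_limit_cong'[of "ball z \<rho>" v v "pdiff i U" V sequentially] by blast
qed

text \<open>Differentiating a word \<open>L\<close> with \<open>length L < r\<close> once more in
  direction \<open>i\<close> consumes a bound for \<open>i # i # L\<close>, of length at most
  \<open>Suc r\<close>. Bounds up to order \<open>r + 1\<close> thus give convergence up to order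
  \<open>r\<close>.\<close>

lemma uniform_limit_pdl:
  fixes g :: "nat \<Rightarrow> real^'n::finite \<Rightarrow> real"
  assumes Cr: "\<And>n. Cr (Suc r) UNIV (g n)"
    and bdd: "\<And>n L y. length L \<le> Suc r \<Longrightarrow> y \<in> ball z \<delta> \<Longrightarrow> \<bar>pdl L (g n) y\<bar> \<le> M"
    and lim: "\<And>\<rho>. \<rho> < \<delta> \<Longrightarrow> uniform_limit (ball z \<rho>) g f sequentially"
    and "length L \<le> r" "\<rho> < \<delta>"
  shows "uniform_limit (ball z \<rho>) (\<lambda>n. pdl L (g n)) (pdl L f) sequentially"
  using assms(4,5)
proof (induction L arbitrary: \<rho>)
  case Nil
  then show ?case using lim by simp
next
  case (Cons i L)
  have "uniform_limit (ball z \<rho>) (\<lambda>n. pdl (i # L) (g n)) (pdiff i (pdl L f)) sequentially"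
    by (rule uniform_limit_partial[where u = "\<lambda>n. pdl L (g n)" and w = "\<lambda>n. pdl (i # i # L) (g n)" and M = M and \<delta> = \<delta>])
      (use Cons bdd[of "i # i # L"] in \<open>auto intro!: Cr_partial[OF Cr] simp del: pdl_Cons\<close>)
  then show ?case by simp
qed

text \<open>An estimate valid for every admissible essential bound passes to their infimum. The set
  is nonempty by essential boundedness, \<open>max C 0\<close> enforcing the sign.\<close>

lemma Linf_norm_boundI:
  assumes "Linf \<Omega> h" "\<And>C. 0 \<le> C \<Longrightarrow> (AE x in lborel. x \<in> \<Omega> \<longrightarrow> \<bar>h x\<bar> \<le> C) \<Longrightarrow> b \<le> C"
  shows "b \<le> Linf_norm \<Omega> h"
  unfolding Linf_norm_def
proof (rule cInf_greatest)
  obtain C where C: "AE x in lborel. x \<in> \<Omega> \<longrightarrow> \<bar>h x\<bar> \<le> C" using assms(1) by (auto simp: Linf_def)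
  have "AE x in lborel. x \<in> \<Omega> \<longrightarrow> \<bar>h x\<bar> \<le> max C 0" using C by eventually_elim auto
  then show "{C. 0 \<le> C \<and> (AE x in lborel. x \<in> \<Omega> \<longrightarrow> \<bar>h x\<bar> \<le> C)} \<noteq> {}"
    by (auto intro!: exI[of _ "max C 0"])
qed (use assms(2) in auto)

text \<open>A continuous function in \<open>W\<^sup>r\<^sup>+\<^sup>1\<^sub>\<infinity>\<close> has classical derivatives up to order \<open>r\<close>; this is
  extracted here as convergence of the derivatives of its mollifications, whose derivatives of
  order \<open>r + 1\<close> obey the bounds of the weak derivatives.\<close>

lemma exists_smooth_approximation:
  fixes f :: "real^'n::finite \<Rightarrow> real"
  assumes op: "open \<Omega>" and cont: "continuous_on \<Omega> f" and W: "Winf (Suc r) \<Omega> f"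
    and K: "compact K" "K \<subseteq> \<Omega>" and z: "z \<in> K"
  obtains g where "\<And>n. Cr (Suc r) UNIV (g n)"
    "\<And>n \<alpha> y. mabs \<alpha> = Suc r \<Longrightarrow> y \<in> K \<Longrightarrow>
      \<bar>mdiff \<alpha> (g n) y\<bar> \<le> Linf_norm \<Omega> (SOME h. Linf \<Omega> h \<and> weak_deriv \<Omega> \<alpha> f h)"
    "\<And>y. y \<in> K \<Longrightarrow> (\<lambda>n. g n y) \<longlonglongrightarrow> f y"
    "\<And>\<alpha>. mabs \<alpha> \<le> r \<Longrightarrow> (\<lambda>n. mdiff \<alpha> (g n) z) \<longlonglongrightarrow> mdiff \<alpha> f z"
proof -
  \<comment> \<open>The same representative that \<open>Winf_semi\<close> selects. The mollification
    estimate holds for every weak derivative, hence for this one.\<close>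
  define h where "h \<alpha> = (SOME h. Linf \<Omega> h \<and> weak_deriv \<Omega> \<alpha> f h)" for \<alpha>
  have h: "Linf \<Omega> (h \<alpha>)" "weak_deriv \<Omega> \<alpha> f (h \<alpha>)" if "mabs \<alpha> \<le> Suc r" for \<alpha>
    using W that someI_ex[of "\<lambda>h. Linf \<Omega> h \<and> weak_deriv \<Omega> \<alpha> f h"] unfolding Winf_def h_def by blast+
  obtain d where d: "d > 0" "(\<Union>y\<in>K. ball y d) \<subseteq> \<Omega>"
    using compact_subset_open_imp_ball_epsilon_subset[OF K(1) op K(2)] by blast
  \<comment> \<open>\<open>d\<close> is the margin of \<open>K\<close> inside \<Omega>. Near
    \<open>z\<close> convergence is studied on \<open>ball z \<delta>\<close>, and mollification
    radii stay below \<open>\<delta> / 2\<close>, so all balls involved lie in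
    \<open>cball z (3 / 2 * \<delta>)\<close>, inside \<open>ball z d\<close>.\<close>
  define \<delta> where "\<delta> = d / 2"
  have \<delta>: "\<delta> > 0" using d by (simp add: \<delta>_def)
  obtain R0 where R0: "\<And>y. y \<in> K \<Longrightarrow> norm y \<le> R0"
    using compact_imp_bounded[OF K(1)] unfolding bounded_iff by blast
  define R where "R = R0 + d"
  have near: "ball y d \<subseteq> \<Omega> \<inter> ball 0 R" if "y \<in> K" for y
  proof -
    have "norm v < R" if "dist y v < d" for v
      using R0[OF \<open>y \<in> K\<close>] norm_triangle_sub[of v y] that by (simp add: R_def dist_norm norm_minus_commute)
    then show ?thesis using d(2) that by auto
  qed
  define \<epsilon> where "\<epsilon> n = \<delta> / (real n + 2)" for n
  have \<epsilon>: "\<epsilon> n > 0" "\<epsilon> n \<le> \<delta> / 2" for n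
    unfolding \<epsilon>_def using \<delta> by (auto simp: field_simps)
  have \<epsilon>_lim: "\<epsilon> \<longlonglongrightarrow> 0"
  proof -
    have "(\<lambda>n. \<delta> * (1 / real (n + 2))) \<longlonglongrightarrow> \<delta> * 0"
      by (intro tendsto_mult tendsto_const LIMSEQ_ignore_initial_segment[OF lim_1_over_n])
    then show ?thesis by (simp add: \<epsilon>_def[abs_def] add.commute)
  qed
  have cb1: "cball y (\<epsilon> n) \<subseteq> \<Omega> \<inter> ball 0 R" if "y \<in> K" for y n
    using near[OF that] \<epsilon>(2)[of n] \<delta> by (auto simp: \<delta>_def subset_iff)
  have cb2: "cball y (\<epsilon> n) \<subseteq> cball z (3 / 2 * \<delta>)" if "y \<in> ball z \<delta>" for y n
  proof
    fix v assume "v \<in> cball y (\<epsilon> n)"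
    then show "v \<in> cball z (3 / 2 * \<delta>)"
      using that \<epsilon>(2)[of n] dist_triangle[of z v y] by simp
  qed
  have cbz: "cball z (3 / 2 * \<delta>) \<subseteq> \<Omega> \<inter> ball 0 R"
    using near[OF z] d(1) by (force simp: \<delta>_def)
  define Q where "Q n g \<longleftrightarrow> (\<forall>m. Cr m UNIV g) \<and>
      (\<forall>\<alpha> h C y. weak_deriv \<Omega> \<alpha> f h \<longrightarrow> (AE u in lborel. u \<in> \<Omega> \<longrightarrow> \<bar>h u\<bar> \<le> C) \<longrightarrow> 0 \<le> C \<longrightarrow>
        cball y (\<epsilon> n) \<subseteq> \<Omega> \<inter> ball 0 R \<longrightarrow> \<bar>mdiff \<alpha> g y\<bar> \<le> C) \<and>
      (\<forall>y \<eta>. cball y (\<epsilon> n) \<subseteq> \<Omega> \<inter> ball 0 R \<longrightarrow> (\<forall>u\<in>cball y (\<epsilon> n). \<bar>f u - f y\<bar> \<le> \<eta>) \<longrightarrow> \<bar>g y - f y\<bar> \<le> \<eta>)"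
    for n g
  have "\<exists>g. Q n g" for n
  proof -
    have "Linf \<Omega> f" using W by (simp add: Winf_def)
    show ?thesis
    proof (rule exists_mollification[OF op \<open>Linf \<Omega> f\<close> \<epsilon>(1)[of n], where R = R])
      fix g assume g: "\<And>m. Cr m UNIV g"
        "\<And>\<alpha> h C y. weak_deriv \<Omega> \<alpha> f h \<Longrightarrow> AE u in lborel. u \<in> \<Omega> \<longrightarrow> \<bar>h u\<bar> \<le> C \<Longrightarrow> 0 \<le> C \<Longrightarrow>
          cball y (\<epsilon> n) \<subseteq> \<Omega> \<inter> ball 0 R \<Longrightarrow> \<bar>mdiff \<alpha> g y\<bar> \<le> C"
        "\<And>y \<eta>. cball y (\<epsilon> n) \<subseteq> \<Omega> \<inter> ball 0 R \<Longrightarrow> (\<And>u. u \<in> cball y (\<epsilon> n) \<Longrightarrow> \<bar>f u - f y\<bar> \<le> \<eta>) \<Longrightarrow>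
          \<bar>g y - f y\<bar> \<le> \<eta>"
      show ?thesis
        unfolding Q_def by (intro exI[of _ g] conjI allI impI; (rule g(1) | rule g(2) | rule g(3)); blast?)
    qed
  qed
  then obtain g where Q: "\<And>n. Q n (g n)" by metis
  have Cr_g: "\<And>n m. Cr m UNIV (g n)"
    and g_weak: "\<And>n \<alpha> h C y. weak_deriv \<Omega> \<alpha> f h \<Longrightarrow> AE u in lborel. u \<in> \<Omega> \<longrightarrow> \<bar>h u\<bar> \<le> C \<Longrightarrow> 0 \<le> C \<Longrightarrow>
        cball y (\<epsilon> n) \<subseteq> \<Omega> \<inter> ball 0 R \<Longrightarrow> \<bar>mdiff \<alpha> (g n) y\<bar> \<le> C"
    and g_near: "\<And>n y \<eta>. cball y (\<epsilon> n) \<subseteq> \<Omega> \<inter> ball 0 R \<Longrightarrow> (\<And>u. u \<in> cball y (\<epsilon> n) \<Longrightarrow> \<bar>f u - f y\<bar> \<le> \<eta>) \<Longrightarrow>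
        \<bar>g n y - f y\<bar> \<le> \<eta>"
    using Q unfolding Q_def by blast+
  have bound: "\<bar>mdiff \<alpha> (g n) y\<bar> \<le> Linf_norm \<Omega> (h \<alpha>)"
    if "mabs \<alpha> \<le> Suc r" "cball y (\<epsilon> n) \<subseteq> \<Omega> \<inter> ball 0 R" for \<alpha> n y
    using h[OF that(1)] g_weak[OF _ _ _ that(2)] by (intro Linf_norm_boundI) auto
  \<comment> \<open>A single constant for all words of length at most \<open>Suc r\<close>, as the
    propagation of uniform convergence demands.\<close>
  define M where "M = (\<Sum>\<alpha> | mabs \<alpha> \<le> Suc r. \<bar>Linf_norm \<Omega> (h \<alpha>)\<bar>)"
  have bdd: "\<bar>pdl L (g n) y\<bar> \<le> M" if "length L \<le> Suc r" "y \<in> ball z \<delta>" for n L y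
  proof -
    have "cball y (\<epsilon> n) \<subseteq> \<Omega> \<inter> ball 0 R" using cb2[OF that(2)] cbz by blast
    then have "\<bar>mdiff (count_list L) (g n) y\<bar> \<le> Linf_norm \<Omega> (h (count_list L))"
      using that(1) by (intro bound) auto
    also have "\<dots> \<le> \<bar>Linf_norm \<Omega> (h (count_list L))\<bar>" by simp
    also have "\<dots> \<le> M"
      unfolding M_def using that(1) by (intro member_le_sum[of "count_list L"]) auto
    finally show ?thesis
      using pdl_eq_mdiff[OF open_UNIV Cr_g[of "length L" n], of L y] by simp
  qed
  have unif: "uniform_limit (ball z \<rho>) g f sequentially" if "\<rho> < \<delta>" for \<rho>
    unfolding uniform_limit_iff
  proof (intro allI impI)
    fix e :: real assume e: "e > 0"
    have "uniformly_continuous_on (cball z (3 / 2 * \<delta>)) f"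
      using cont cbz by (intro compact_uniformly_continuous) (auto intro: continuous_on_subset)
    then obtain s where s: "s > 0" "\<And>u v. u \<in> cball z (3 / 2 * \<delta>) \<Longrightarrow> v \<in> cball z (3 / 2 * \<delta>) \<Longrightarrow>
        dist u v < s \<Longrightarrow> dist (f u) (f v) < e / 2"
      using e half_gt_zero[OF e] unfolding uniformly_continuous_on_def by metis
    have "\<forall>\<^sub>F n in sequentially. \<epsilon> n < s" using \<epsilon>_lim s(1) by (rule order_tendstoD)
    then show "\<forall>\<^sub>F n in sequentially. \<forall>y\<in>ball z \<rho>. dist (g n y) (f y) < e"
    proof eventually_elim
      case (elim n)
      show ?case
      proof
        fix y assume "y \<in> ball z \<rho>"
        then have y: "y \<in> ball z \<delta>" using that by auto
        have "\<bar>g n y - f y\<bar> \<le> e / 2"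
        proof (rule g_near)
          show "cball y (\<epsilon> n) \<subseteq> \<Omega> \<inter> ball 0 R" using cb2[OF y] cbz by blast
          fix u assume u: "u \<in> cball y (\<epsilon> n)"
          have "dist (f u) (f y) < e / 2"
            using u elim cb2[OF y, of n] \<epsilon>(1)[of n] by (intro s(2)) (auto simp: dist_commute subset_iff)
          then show "\<bar>f u - f y\<bar> \<le> e / 2" by (simp add: dist_real_def)
        qed
        then show "dist (g n y) (f y) < e" using e by (simp add: dist_real_def)
      qed
    qed
  qed
  show ?thesis
  proof (rule that[of g])
    show "Cr (Suc r) UNIV (g n)" for n by (rule Cr_g)
    show "\<bar>mdiff \<alpha> (g n) y\<bar> \<le> Linf_norm \<Omega> (SOME h. Linf \<Omega> h \<and> weak_deriv \<Omega> \<alpha> f h)"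
      if "mabs \<alpha> = Suc r" "y \<in> K" for n \<alpha> y
      using bound[OF _ cb1[OF that(2)], of \<alpha> n] that(1) by (simp add: h_def)
    show "(\<lambda>n. g n y) \<longlonglongrightarrow> f y" if y: "y \<in> K" for y
    proof (rule tendstoI)
      fix e :: real assume e: "e > 0"
      obtain s where s: "s > 0" "\<And>u. u \<in> \<Omega> \<Longrightarrow> dist u y < s \<Longrightarrow> dist (f u) (f y) < e / 2"
        using cont y K(2) half_gt_zero[OF e] unfolding continuous_on_iff by (metis subsetD)
      have "\<forall>\<^sub>F n in sequentially. \<epsilon> n < s" using \<epsilon>_lim s(1) by (rule order_tendstoD)
      then show "\<forall>\<^sub>F n in sequentially. dist (g n y) (f y) < e"
      proof eventually_elim
        case (elim n)
        have "\<bar>g n y - f y\<bar> \<le> e / 2"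
        proof (rule g_near[OF cb1[OF y]])
          fix u assume u: "u \<in> cball y (\<epsilon> n)"
          have "dist (f u) (f y) < e / 2"
            using u elim cb1[OF y, of n] by (intro s(2)) (auto simp: dist_commute subset_iff)
          then show "\<bar>f u - f y\<bar> \<le> e / 2" by (simp add: dist_real_def)
        qed
        then show ?case using e by (simp add: dist_real_def)
      qed
    qed
    show "(\<lambda>n. mdiff \<alpha> (g n) z) \<longlonglongrightarrow> mdiff \<alpha> f z" if "mabs \<alpha> \<le> r" for \<alpha>
    proof -
      have "uniform_limit (ball z (\<delta> / 2)) (\<lambda>n. pdl (mlist \<alpha>) (g n)) (pdl (mlist \<alpha>) f) sequentially"
        by (rule uniform_limit_pdl[OF Cr_g bdd unif]) (use that \<delta> in auto)
      then show ?thesis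
        unfolding mdiff_mlist by (rule tendsto_uniform_limitI) (use \<delta> in simp)
    qed
  qed
qed

theorem mainTheorem16:
  fixes k q N :: nat
    and c :: "('n::finite \<Rightarrow> nat) \<Rightarrow> real"
    and z :: "real^'n"
    and x :: "nat \<Rightarrow> real^'n"
    and \<theta> w :: "nat \<Rightarrow> real"
    and \<Omega> :: "(real^'n) set"
  assumes c_supp: "\<And>\<alpha>. mabs \<alpha> > k \<Longrightarrow> c \<alpha> = 0"
    and c_order: "(\<Sum>\<alpha>\<in>{\<alpha>. mabs \<alpha> = k}. \<bar>c \<alpha>\<bar>) \<noteq> 0"
    and qk: "q > k"
    and distinct: "inj_on x {..<N}"
    and unisolv: "unisolvent q N x"
    and theta_pos: "\<And>j. j < N \<Longrightarrow> \<theta> j > 0"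
    and w_def: "\<And>v. Dop k c (lsq q N \<theta> x v) z = (\<Sum>j<N. w j * v j)"
    and dom: "open \<Omega>" "connected \<Omega>"
    and S_sub: "(\<Union>j<N. closed_segment z (x j)) \<subseteq> \<Omega>"
  shows "(\<forall>r \<gamma> f. k \<le> r \<and> r \<le> q - 1 \<and> 0 < \<gamma> \<and> \<gamma> \<le> 1 \<and> Crgamma r \<gamma> \<Omega> f \<longrightarrow>
            \<bar>Dop k c f z - (\<Sum>j<N. w j * f (x j))\<bar>
              \<le> rho q k c z N x \<theta> * sqrt (\<Sum>j<N. \<theta> j * norm (x j - z) powr (2 * (real r + \<gamma>)))
                 * Crgamma_semi r \<gamma> \<Omega> f)
       \<and> (convex hull (insert z (x ` {..<N})) \<subseteq> \<Omega> \<longrightarrow>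
          (\<forall>r f. k \<le> r \<and> r \<le> q - 1 \<and> continuous_on \<Omega> f \<and> Winf (r + 1) \<Omega> f \<longrightarrow>
            \<bar>Dop k c f z - (\<Sum>j<N. w j * f (x j))\<bar>
              \<le> rho q k c z N x \<theta> * sqrt (\<Sum>j<N. \<theta> j * norm (x j - z) ^ (2 * r + 2))
                 * Winf_semi (r + 1) \<Omega> f))"
proof (intro conjI impI allI; elim conjE)
  note error_bound = numdiff_error_bound[OF unisolv theta_pos w_def]
  have seg: "closed_segment z (x j) \<subseteq> \<Omega>" if "j < N" for j using S_sub that by auto
  {
    fix r \<gamma> f
    assume r: "k \<le> r" "r \<le> q - 1" and \<gamma>: "0 < \<gamma>" "\<gamma> \<le> 1" and f: "Crgamma r \<gamma> \<Omega> f"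
    have "\<bar>Dop k c f z - (\<Sum>j<N. w j * f (x j))\<bar>
        \<le> rho q k c z N x \<theta> * sqrt (\<Sum>j<N. \<theta> j * (norm (x j - z) powr (real r + \<gamma>))\<^sup>2) * Crgamma_semi r \<gamma> \<Omega> f"
    proof (rule error_bound)
      show "\<bar>f (x j) - taylor_poly r f z (x j)\<bar> \<le> norm (x j - z) powr (real r + \<gamma>) * Crgamma_semi r \<gamma> \<Omega> f"
        if "j < N" for j by (rule taylor_bound_holder[OF dom(1) f seg[OF that] \<gamma>(1)])
      show "0 \<le> Crgamma_semi r \<gamma> \<Omega> f"
        unfolding Crgamma_semi_def using \<gamma>
        by (intro mult_nonneg_nonneg divide_nonneg_nonneg prod_nonneg real_sqrt_ge_zero sum_nonneg)
          (auto simp: mfact_def intro!: prod_nonneg)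
    qed (use r qk in auto)
    then show "\<bar>Dop k c f z - (\<Sum>j<N. w j * f (x j))\<bar>
        \<le> rho q k c z N x \<theta> * sqrt (\<Sum>j<N. \<theta> j * norm (x j - z) powr (2 * (real r + \<gamma>))) * Crgamma_semi r \<gamma> \<Omega> f"
      by (simp add: powr_power[symmetric] mult.commute[of 2] powr_powr[symmetric] power2_eq_square flip: powr_add)
  next
    fix r f
    assume r: "k \<le> r" "r \<le> q - 1" and cont: "continuous_on \<Omega> f" and "Winf (r + 1) \<Omega> f"
    then have W: "Winf (Suc r) \<Omega> f" by simp
    let ?K = "insert z (\<Union>j<N. closed_segment z (x j))"
    \<comment> \<open>Without nodes the constant polynomial 1 would contradict unisolvence. A first
      segment is needed to see that \<open>z\<close> lies in \<Omega>.\<close>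
    have "N > 0"
    proof (rule ccontr)
      assume "\<not> N > 0"
      moreover have "(\<lambda>y::real^'n. \<Prod>i\<in>UNIV. (y $ i) ^ (\<lambda>_. 0 :: nat) i) \<in> polys q"
        by (rule polys_monomial) (use qk in \<open>simp add: mabs_def\<close>)
      ultimately have "(\<lambda>y::real^'n. 1::real) = (\<lambda>_. 0)"
        using unisolv unfolding unisolvent_def by simp
      then show False by (auto dest: fun_cong)
    qed
    then have K: "compact ?K" "?K \<subseteq> \<Omega>" using S_sub seg[of 0] by (auto intro!: compact_UN compact_insert)
    obtain g where Cr_g: "\<And>n. Cr (Suc r) UNIV (g n)"
      and g_bound: "\<And>n \<alpha> y. mabs \<alpha> = Suc r \<Longrightarrow> y \<in> ?K \<Longrightarrow>
        \<bar>mdiff \<alpha> (g n) y\<bar> \<le> Linf_norm \<Omega> (SOME h. Linf \<Omega> h \<and> weak_deriv \<Omega> \<alpha> f h)"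
      and g_lim: "\<And>y. y \<in> ?K \<Longrightarrow> (\<lambda>n. g n y) \<longlonglongrightarrow> f y"
      and g_lim_z: "\<And>\<alpha>. mabs \<alpha> \<le> r \<Longrightarrow> (\<lambda>n. mdiff \<alpha> (g n) z) \<longlonglongrightarrow> mdiff \<alpha> f z"
      using exists_smooth_approximation[OF dom(1) cont W K, of z] by blast
    \<comment> \<open>Each \<open>g n\<close> is smooth on the whole space, but its derivatives of
      order \<open>r + 1\<close> are controlled only on \<open>?K\<close>, which contains the
      segments of the Taylor estimate.\<close>
    have bound_g: "\<bar>Dop k c (g n) z - (\<Sum>j<N. w j * g n (x j))\<bar>
        \<le> rho q k c z N x \<theta> * sqrt (\<Sum>j<N. \<theta> j * (norm (x j - z) ^ Suc r)\<^sup>2) * Winf_semi (Suc r) \<Omega> f" for n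
    proof (rule error_bound)
      show "\<bar>g n (x j) - taylor_poly r (g n) z (x j)\<bar> \<le> norm (x j - z) ^ Suc r * Winf_semi (Suc r) \<Omega> f"
        if "j < N" for j
        unfolding Winf_semi_def
        by (rule taylor_bound_derivative[OF open_UNIV Cr_g]) (use g_bound that in auto)
      show "0 \<le> Winf_semi (Suc r) \<Omega> f"
        unfolding Winf_semi_def
        by (intro mult_nonneg_nonneg divide_nonneg_nonneg real_sqrt_ge_zero sum_nonneg)
          (auto simp: mfact_def intro!: prod_nonneg)
    qed (use r qk in auto)
    have "x j \<in> ?K" if "j < N" for j using that by auto
    \<comment> \<open>The operator involves derivatives of order at most \<open>k \<le> r\<close>,
      exactly the range in which the derivatives of \<open>g n\<close> at \<open>z\<close>
      converge.\<close>
    then have "(\<lambda>n. \<bar>Dop k c (g n) z - (\<Sum>j<N. w j * g n (x j))\<bar>) \<longlonglongrightarrow> \<bar>Dop k c f z - (\<Sum>j<N. w j * f (x j))\<bar>"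
      unfolding Dop_def using r g_lim_z g_lim by (intro tendsto_intros) auto
    then have "\<bar>Dop k c f z - (\<Sum>j<N. w j * f (x j))\<bar>
        \<le> rho q k c z N x \<theta> * sqrt (\<Sum>j<N. \<theta> j * (norm (x j - z) ^ Suc r)\<^sup>2) * Winf_semi (Suc r) \<Omega> f"
      using bound_g by (intro LIMSEQ_le_const2) auto
    then show "\<bar>Dop k c f z - (\<Sum>j<N. w j * f (x j))\<bar>
        \<le> rho q k c z N x \<theta> * sqrt (\<Sum>j<N. \<theta> j * norm (x j - z) ^ (2 * r + 2)) * Winf_semi (r + 1) \<Omega> f"
      by (simp add: power_mult[symmetric] mult.commute flip: power_Suc)
  }
qed

end
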